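(* For an oriented virtual knot diagram $K$ and an integer $n\ge 1$, let $$v_n(K)=\frac{1}{n!}\sum_{c}\mathrm{sgn}(c)\,W_K(c)^n,$$ where $c$ runs over all classical crossings of $K$, $\mathrm{sgn}(c)$ is the sign of $c$, and $W_K(c)$ is the weight (index) of $c$. Then $v_n$ is a finite type Vassiliev invariant of virtual knots of order $\lceil n/2\rceil$.
   Context: A virtual link diagram is a generically immersed collection of closed curves in the plane in which every double point is either a classical crossing (with over/under information) or a virtual crossing (no over/under information). A virtual knot diagram is one with a single component. Virtual isotopy is the equivalence relation on virtual link diagrams, taken up to planar isotopy, generated by the classical Reidemeister moves I, II, III (involving only classical crossings) and the detour move: an arc containing a consecutive sequence of virtual crossings and no classical crossings may be excised and replaced by any other arc with the same endpoints, all of whose crossings with the rest of the diagram and with itself are virtual. Oriented virtual knots are oriented virtual knot diagrams modulo oriented virtual isotopy. The underlying flat diagram of a virtual diagram is obtained by forgetting the over/under information at classical crossings. An arc of an oriented diagram is an edge going, in the direction of orientation, from one classical crossing to the next, possibly passing through virtual crossings. (If a component has no classical crossings, the whole component is a single arc.) A Cheng coloring of an oriented (flat) virtual diagram is an assignment of an integer to each arc such that the following holds at each classical crossing. Draw the crossing with both strands directed upward, with left incoming arc labeled $a$ and right incoming arc labeled $b$. Then the right outgoing arc (the continuation of the left incoming strand) is labeled $a-1$, and the left outgoing arc (the continuation of the right incoming strand) is labeled $b+1$. Labels do not change at virtual crossings. Every oriented flat virtual knot diagram has a Cheng coloring, unique up to adding a constant integer to all labels. At a classical crossing $c$ with left incoming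 label $a$ and right incoming label $b$, put $W_+(c)=a-(b+1)$ and $W_-(c)=b-(a-1)=-W_+(c)$. These do not depend on the choice of Cheng coloring of the knot diagram. The sign $\mathrm{sgn}(c)\in\{+1,-1\}$ of a classical crossing is the usual one. With both strands directed upward, $\mathrm{sgn}(c)=+1$ if the overcrossing strand goes from lower left to upper right, and $\mathrm{sgn}(c)=-1$ if it goes from lower right to upper left. The weight of $c$ in $K$ is $W_K(c)=W_+(c)$ if $\mathrm{sgn}(c)=+1$ and $W_K(c)=W_-(c)$ if $\mathrm{sgn}(c)=-1$. An invariant $v$ of oriented virtual knots is extended to singular diagrams (virtual $4$-regular graph diagrams, in which some of the double points are graphical nodes, i.e. neither classical nor virtual crossings) by the rule $v(K_* )=v(K_+)-v(K_-)$. Here $K_*$ has a graphical node at a given site, and $K_+$ and $K_-$ are obtained from $K_*$ by replacing that node by a positive, respectively negative, classical crossing; the rule is applied repeatedly to all nodes. The invariant $v$ is a Vassiliev invariant of order $m$ if its extension vanishes on all singular diagrams with more than $m$ nodes. *)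

theory Defs
  imports "HOL-Analysis.Analysis"
begin

section \<open>Oriented virtual knot diagrams\<close>

text \<open>
  The plane is the type of complex numbers.  An oriented closed curve is a 1-periodic function of a
  real parameter, so that parameters differing by an integer stand for the same point of the
  circle.  \<open>over\<close> and \<open>under\<close> are the (periodic) sets of parameters at which the curve passes a
  classical crossing as over- resp. undercrossing strand.  \<open>nodes\<close> is the set of graphical nodes,
  as points of the plane.  The remaining double points are the virtual crossings.
\<close>

record vdiagram =
  curve :: "real \<Rightarrow> complex"
  over :: "real set"
  under :: "real set"
  nodes :: "complex set"

abbreviation velocity :: "vdiagram \<Rightarrow> real \<Rightarrow> complex" where
  "velocity K u \<equiv> vector_derivative (curve K) (at u)"

text \<open>Determinant of a pair of plane vectors; positive iff \<open>b\<close> points to the left of \<open>a\<close>.\<close>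

definition cross :: "complex \<Rightarrow> complex \<Rightarrow> real" where
  "cross a b = Re a * Im b - Im a * Re b"

definition double_points :: "vdiagram \<Rightarrow> complex set" where
  "double_points K = {p. \<exists>u v. curve K u = p \<and> curve K v = p \<and> u - v \<notin> \<int>}"

text \<open>A generic immersion of class \<open>C\<^sup>1\<close> of one circle: finitely many multiple points, all of them
  transverse and double.\<close>

definition generic_closed_curve :: "vdiagram \<Rightarrow> bool" where
  "generic_closed_curve K \<longleftrightarrow>
     (\<forall>u. curve K (u + 1) = curve K u) \<and>
     curve K C1_differentiable_on UNIV \<and>
     (\<forall>u. velocity K u \<noteq> 0) \<and>
     finite (double_points K) \<and>
     (\<forall>u v. curve K u = curve K v \<and> u - v \<notin> \<int> \<longrightarrow> cross (velocity K u) (velocity K v) \<noteq> 0) \<and>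
     (\<forall>u v w. curve K u = curve K v \<and> curve K v = curve K w \<longrightarrow>
        u - v \<in> \<int> \<or> v - w \<in> \<int> \<or> u - w \<in> \<int>)"

definition singular_knot_diagram :: "vdiagram \<Rightarrow> bool" where
  "singular_knot_diagram K \<longleftrightarrow>
     generic_closed_curve K \<and>
     (\<forall>u. u + 1 \<in> over K \<longleftrightarrow> u \<in> over K) \<and>
     (\<forall>u. u + 1 \<in> under K \<longleftrightarrow> u \<in> under K) \<and>
     over K \<inter> under K = {} \<and>
     curve K ` (over K \<union> under K) \<subseteq> double_points K \<and>
     (\<forall>u v. curve K u = curve K v \<and> u - v \<notin> \<int> \<longrightarrow> (u \<in> over K \<longleftrightarrow> v \<in> under K)) \<and>
     nodes K \<subseteq> double_points K \<and>
     nodes K \<inter> curve K ` (over K \<union> under K) = {}"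

definition virtual_knot_diagram :: "vdiagram \<Rightarrow> bool" where
  "virtual_knot_diagram K \<longleftrightarrow> singular_knot_diagram K \<and> nodes K = {}"

definition classical_crossings :: "vdiagram \<Rightarrow> complex set" where
  "classical_crossings K = curve K ` (over K \<union> under K)"

text \<open>If a double point is drawn with both strands directed upward, the strand going from lower
  left to upper right (the left incoming strand) is the one whose direction turns
  counterclockwise, by less than a half turn, into the direction of the other strand.\<close>

definition left_incoming :: "vdiagram \<Rightarrow> complex \<Rightarrow> real set" where
  "left_incoming K p =
     {u. curve K u = p \<and> (\<exists>v. curve K v = p \<and> cross (velocity K u) (velocity K v) > 0)}"

definition right_incoming :: "vdiagram \<Rightarrow> complex \<Rightarrow> real set" where
  "right_incoming K p =
     {v. curve K v = p \<and> (\<exists>u. curve K u = p \<and> cross (velocity K u) (velocity K v) > 0)}"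

definition crossing_sign :: "vdiagram \<Rightarrow> complex \<Rightarrow> int" where
  "crossing_sign K c = (if \<exists>u \<in> left_incoming K c. u \<in> over K then 1 else -1)"


section \<open>Virtual isotopy\<close>

text \<open>An ambient isotopy of the plane through \<open>C\<^sup>1\<close> diffeomorphisms, starting at the identity.\<close>

definition planar_isotopy :: "(real \<Rightarrow> complex \<Rightarrow> complex) \<Rightarrow> bool" where
  "planar_isotopy H \<longleftrightarrow>
     H 0 = id \<and>
     continuous_on ({0..1} \<times> UNIV) (\<lambda>(t, z). H t z) \<and>
     (\<forall>t\<in>{0..1}. bij (H t)) \<and>
     (\<exists>H' :: real \<Rightarrow> complex \<Rightarrow> complex \<Rightarrow>\<^sub>L complex.
        continuous_on ({0..1} \<times> UNIV) (\<lambda>(t, z). H' t z) \<and>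
        (\<forall>t\<in>{0..1}. \<forall>z. (H t has_derivative blinfun_apply (H' t z)) (at z) \<and>
                         inj (blinfun_apply (H' t z))))"

text \<open>An orientation preserving change of parameter of the circle (including a change of base
  point).\<close>

definition circle_reparametrization :: "(real \<Rightarrow> real) \<Rightarrow> bool" where
  "circle_reparametrization \<phi> \<longleftrightarrow>
     \<phi> C1_differentiable_on UNIV \<and> (\<forall>u. \<phi> (u + 1) = \<phi> u + 1) \<and> (\<forall>u. deriv \<phi> u > 0)"

text \<open>
  Since planar isotopies are available separately, it is enough to perform the Reidemeister moves
  inside one standard square and on explicit pictures.  A picture is a list of strands, each a curve
  parametrized by \<open>{-1..1}\<close> running from the left side of the square to the right side.  A diagram
  may run through a strand in either direction: strand \<open>i\<close> is traversed at the parameters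
  \<open>c i + r i * t\<close>, from left to right if \<open>r i > 0\<close> and from right to left if \<open>r i < 0\<close>.
\<close>

definition window :: "complex set" where
  "window = {z. \<bar>Re z\<bar> \<le> 1 \<and> \<bar>Im z\<bar> \<le> 1}"

definition strand :: "(nat \<Rightarrow> real) \<Rightarrow> (nat \<Rightarrow> real) \<Rightarrow> nat \<Rightarrow> real set" where
  "strand c r i = {c i + r i * t + of_int k | t (k::int). t \<in> {-1..1}}"

definition shows_picture ::
  "vdiagram \<Rightarrow> (real \<Rightarrow> complex) list \<Rightarrow> (nat \<Rightarrow> real) \<Rightarrow> (nat \<Rightarrow> real) \<Rightarrow> bool" where
  "shows_picture K T c r \<longleftrightarrow>
     (\<forall>i<length T. r i \<noteq> 0 \<and> 2 * \<bar>r i\<bar> < 1) \<and>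
     disjoint_family_on (strand c r) {..<length T} \<and>
     (\<forall>i<length T. \<forall>t\<in>{-1..1}. curve K (c i + r i * t) = (T ! i) t) \<and>
     curve K -` window = (\<Union>i<length T. strand c r i)"

text \<open>All crossings in the window are classical; crossings of different strands are resolved
  according to the heights \<open>h\<close> of the strands.\<close>

definition layered ::
  "vdiagram \<Rightarrow> nat \<Rightarrow> (nat \<Rightarrow> real) \<Rightarrow> (nat \<Rightarrow> real) \<Rightarrow> (nat \<Rightarrow> nat) \<Rightarrow> bool" where
  "layered K m c r h \<longleftrightarrow>
     double_points K \<inter> window \<subseteq> classical_crossings K \<and>
     (\<forall>i<m. \<forall>j<m. \<forall>u \<in> strand c r i. \<forall>v \<in> strand c r j.
        curve K u = curve K v \<and> h i > h j \<longrightarrow> u \<in> over K \<and> v \<in> under K)"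

definition picture_move ::
  "(real \<Rightarrow> complex) list \<Rightarrow> (real \<Rightarrow> complex) list \<Rightarrow> vdiagram \<Rightarrow> vdiagram \<Rightarrow> bool" where
  "picture_move T T' K K' \<longleftrightarrow>
     length T = length T' \<and>
     (\<exists>c r h. inj_on h {..<length T} \<and>
        shows_picture K T c r \<and> layered K (length T) c r h \<and>
        shows_picture K' T' c r \<and> layered K' (length T) c r h \<and>
        (\<forall>u. u \<notin> (\<Union>i<length T. strand c r i) \<longrightarrow>
           curve K' u = curve K u \<and> (u \<in> over K' \<longleftrightarrow> u \<in> over K) \<and>
           (u \<in> under K' \<longleftrightarrow> u \<in> under K)))"

text \<open>A bump on \<open>{-1..1}\<close>, flat at the end points, with value 1 exactly at \<open>t = 1/2\<close> and
  \<open>t = -1/2\<close> and maximum \<open>16/9\<close> at \<open>t = 0\<close>.\<close>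

definition bump :: "real \<Rightarrow> real" where
  "bump t = 16 / 9 * (1 - t\<^sup>2)\<^sup>2"

text \<open>Move I: a straight strand becomes a kink, whose only double point is \<open>Complex 0 (1/2)\<close>, passed
  at \<open>t = -1/2\<close> and at \<open>t = 1/2\<close>.  The loop is counterclockwise or clockwise according to the
  direction of traversal, and both kinds of crossing are allowed.\<close>

definition R1_before :: "(real \<Rightarrow> complex) list" where
  "R1_before = [\<lambda>t. Complex t 0]"

definition R1_after :: "(real \<Rightarrow> complex) list" where
  "R1_after = [\<lambda>t. Complex (t * (1 - bump t)) (bump t / 2)]"

text \<open>Move II: of two parallel strands, the upper one is pushed down across the lower one, over or
  under it, which creates the two crossings at \<open>t = -1/2\<close> and \<open>t = 1/2\<close>.\<close>

definition R2_before :: "(real \<Rightarrow> complex) list" where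
  "R2_before = [\<lambda>t. Complex t 0, \<lambda>t. Complex t (1 / 2)]"

definition R2_after :: "(real \<Rightarrow> complex) list" where
  "R2_after = [\<lambda>t. Complex t 0, \<lambda>t. Complex t ((1 - bump t) / 2)]"

text \<open>Move III: two straight strands cross at the origin; the third strand passes above
  this crossing before the move and below it afterwards.\<close>

definition R3_before :: "(real \<Rightarrow> complex) list" where
  "R3_before = [\<lambda>t. Complex t (t / 2), \<lambda>t. Complex t (- t / 2), \<lambda>t. Complex t (bump t / 4)]"

definition R3_after :: "(real \<Rightarrow> complex) list" where
  "R3_after = [\<lambda>t. Complex t (t / 2), \<lambda>t. Complex t (- t / 2), \<lambda>t. Complex t (- bump t / 4)]"

text \<open>The detour move replaces the arc with parameters in \<open>{a..b}\<close>.  That the other crossings of the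
  new arc are virtual is expressed by the fact that the classical crossings do not change and are
  not on the arc.\<close>

definition detour_move :: "vdiagram \<Rightarrow> vdiagram \<Rightarrow> bool" where
  "detour_move K K' \<longleftrightarrow>
     (\<exists>a b. a < b \<and> b < a + 1 \<and>
        (\<forall>u\<in>{b..a + 1}. curve K' u = curve K u) \<and>
        over K' = over K \<and> under K' = under K \<and>
        (over K \<union> under K) \<inter> {a..b} = {})"

inductive virtual_move :: "vdiagram \<Rightarrow> vdiagram \<Rightarrow> bool" where
  isotopy: "\<lbrakk>virtual_knot_diagram K; virtual_knot_diagram K'; planar_isotopy H;
     K' = K\<lparr>curve := H 1 \<circ> curve K\<rparr>\<rbrakk> \<Longrightarrow> virtual_move K K'"
| reparametrization: "\<lbrakk>virtual_knot_diagram K; virtual_knot_diagram K'; circle_reparametrization \<phi>;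
     K' = K\<lparr>curve := curve K \<circ> \<phi>, over := \<phi> -` over K, under := \<phi> -` under K\<rparr>\<rbrakk>
     \<Longrightarrow> virtual_move K K'"
| R1: "\<lbrakk>virtual_knot_diagram K; virtual_knot_diagram K'; picture_move R1_before R1_after K K'\<rbrakk>
     \<Longrightarrow> virtual_move K K'"
| R2: "\<lbrakk>virtual_knot_diagram K; virtual_knot_diagram K'; picture_move R2_before R2_after K K'\<rbrakk>
     \<Longrightarrow> virtual_move K K'"
| R3: "\<lbrakk>virtual_knot_diagram K; virtual_knot_diagram K'; picture_move R3_before R3_after K K'\<rbrakk>
     \<Longrightarrow> virtual_move K K'"
| detour: "\<lbrakk>virtual_knot_diagram K; virtual_knot_diagram K'; detour_move K K'\<rbrakk>
     \<Longrightarrow> virtual_move K K'"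

definition virtually_isotopic :: "vdiagram \<Rightarrow> vdiagram \<Rightarrow> bool" where
  "virtually_isotopic = equivclp virtual_move"

definition virtual_knot_invariant :: "(vdiagram \<Rightarrow> 'b) \<Rightarrow> bool" where
  "virtual_knot_invariant v \<longleftrightarrow>
     (\<forall>K K'. virtual_knot_diagram K \<and> virtual_knot_diagram K' \<and> virtually_isotopic K K' \<longrightarrow>
        v K = v K')"


section \<open>Cheng colorings and weights\<close>

text \<open>
  A coloring assigns to a parameter the label of the arc it lies on; its values at the parameters of
  classical crossings are irrelevant.  The labels of the incoming and outgoing arc of a strand at a
  crossing are the one-sided limits.
\<close>

definition in_label :: "(real \<Rightarrow> int) \<Rightarrow> real \<Rightarrow> int" where
  "in_label f u = Lim (at_left u) f"

definition out_label :: "(real \<Rightarrow> int) \<Rightarrow> real \<Rightarrow> int" where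
  "out_label f u = Lim (at_right u) f"

definition cheng_coloring :: "vdiagram \<Rightarrow> (real \<Rightarrow> int) \<Rightarrow> bool" where
  "cheng_coloring K f \<longleftrightarrow>
     (\<forall>u. f (u + 1) = f u) \<and>
     (\<forall>u v. u \<le> v \<and> {u..v} \<inter> (over K \<union> under K) = {} \<longrightarrow> f u = f v) \<and>
     (\<forall>c \<in> classical_crossings K.
        (\<forall>u \<in> left_incoming K c. out_label f u = in_label f u - 1) \<and>
        (\<forall>v \<in> right_incoming K c. out_label f v = in_label f v + 1))"

definition left_label :: "vdiagram \<Rightarrow> (real \<Rightarrow> int) \<Rightarrow> complex \<Rightarrow> int" where
  "left_label K f c = (THE a. \<exists>u \<in> left_incoming K c. a = in_label f u)"

definition right_label :: "vdiagram \<Rightarrow> (real \<Rightarrow> int) \<Rightarrow> complex \<Rightarrow> int" where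
  "right_label K f c = (THE b. \<exists>v \<in> right_incoming K c. b = in_label f v)"

definition W_plus :: "vdiagram \<Rightarrow> (real \<Rightarrow> int) \<Rightarrow> complex \<Rightarrow> int" where
  "W_plus K f c = left_label K f c - (right_label K f c + 1)"

definition W_minus :: "vdiagram \<Rightarrow> (real \<Rightarrow> int) \<Rightarrow> complex \<Rightarrow> int" where
  "W_minus K f c = right_label K f c - (left_label K f c - 1)"

text \<open>The choice of the Cheng coloring does not matter, since it is unique up to a constant.\<close>

definition weight :: "vdiagram \<Rightarrow> complex \<Rightarrow> int" where
  "weight K c =
     (let f = (SOME f. cheng_coloring K f)
      in if crossing_sign K c = 1 then W_plus K f c else W_minus K f c)"

definition v_inv :: "nat \<Rightarrow> vdiagram \<Rightarrow> real" where
  "v_inv n K =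
     1 / fact n *
     (\<Sum>c \<in> classical_crossings K. of_int (crossing_sign K c) * of_int (weight K c) ^ n)"


section \<open>Vassiliev invariants\<close>

definition resolve_positive :: "complex \<Rightarrow> vdiagram \<Rightarrow> vdiagram" where
  "resolve_positive p K =
     K\<lparr>over := over K \<union> left_incoming K p, under := under K \<union> right_incoming K p,
       nodes := nodes K - {p}\<rparr>"

definition resolve_negative :: "complex \<Rightarrow> vdiagram \<Rightarrow> vdiagram" where
  "resolve_negative p K =
     K\<lparr>over := over K \<union> right_incoming K p, under := under K \<union> left_incoming K p,
       nodes := nodes K - {p}\<rparr>"

text \<open>The values of \<open>f\<close> on singular knot diagrams are determined by those of \<open>v\<close> on virtual knot
  diagrams.\<close>

definition vassiliev_extension ::
  "(vdiagram \<Rightarrow> 'b::ab_group_add) \<Rightarrow> (vdiagram \<Rightarrow> 'b) \<Rightarrow> bool" where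
  "vassiliev_extension v f \<longleftrightarrow>
     (\<forall>K. virtual_knot_diagram K \<longrightarrow> f K = v K) \<and>
     (\<forall>K. singular_knot_diagram K \<longrightarrow>
        (\<forall>p \<in> nodes K. f K = f (resolve_positive p K) - f (resolve_negative p K)))"

definition vassiliev_invariant_of_order :: "nat \<Rightarrow> (vdiagram \<Rightarrow> 'b::ab_group_add) \<Rightarrow> bool" where
  "vassiliev_invariant_of_order m v \<longleftrightarrow>
     virtual_knot_invariant v \<and>
     (\<exists>f. vassiliev_extension v f \<and>
        (\<forall>K. singular_knot_diagram K \<and> card (nodes K) > m \<longrightarrow> f K = 0))"

end

(* Each double point has a strand incoming on the left and one incoming on the right, passed at the
   parameters l and r. The function counting, with floors, the right parameters minus the left
   parameters passed so far is a Cheng coloring, and any other one differs from it by a constant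
   because there is only one component. Averaging the labels before and after a crossing turns the
   weight of a crossing p into half of sgn(p) times the sum, over all classical crossings d, of an
   antisymmetric linking number of the chords (l_p, r_p) and (l_d, r_d), in which the signs of the
   other crossings do not occur.

   All moves are read off from this formula. The chord of a kink links no chord, the two chords of a
   bigon have opposite linking numbers with every chord, and the picture of the third move after the
   move is the one before the move rotated by a half turn: only the order of two crossings on the
   same strand changes, and these changes cancel at each of the three crossings.

   Since the contribution of a crossing to v_n depends on its own sign only, the alternating sum over
   the resolutions of two nodes vanishes, so v_n even has order at most 1. *)

theory Submission
  imports Defs
begin

section \<open>Linking numbers of chords and parameters of crossings\<close>

text \<open>The obstacle is that a crossing fixes its two parameters only modulo integers, while
  cutting the circle at a base point would force case distinctions on the cyclic order of four
  endpoints. The odd function \<open>step\<close> avoids both. Since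
  \<open>step (t + of_int k) = step t + 2 * k\<close>, integer shifts of any argument cancel among
  the four terms of \<open>linking\<close>, so arbitrary lifts may be chosen. Moreover
  \<open>step (x - y)\<close> can change only when \<open>x - y\<close> meets an integer, that is,
  when the two points collide on the circle. Hence a strand in the window may be replaced by its
  centre parameter whenever it is compared with something off this strand; actual positions matter
  only for comparisons within one strand. The assumption \<open>n \<ge> 1\<close> enters twice: a
  crossing of index 0 must contribute nothing, and the bound on the order must be at least
  1.\<close>

definition step :: "real \<Rightarrow> int" where
  "step t = \<lfloor>t\<rfloor> + \<lceil>t\<rceil>"

lemma step_minus: "step (- t) = - step t"
  by (simp add: step_def ceiling_def)

lemma step_diff_commute: "step (a - b) = - step (b - a)"
  using step_minus[of "b - a"] by simp

lemma step_add_of_int: "step (t + of_int k) = step t + 2 * k"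
  by (simp add: step_def)

lemma step_0 [simp]: "step 0 = 0"
  by (simp add: step_def)

lemma step_eq_1: "0 < t \<Longrightarrow> t < 1 \<Longrightarrow> step t = 1"
  by (simp add: step_def floor_unique[of 0] ceiling_unique[of 1])

lemma step_eq_minus_1: "-1 < t \<Longrightarrow> t < 0 \<Longrightarrow> step t = -1"
  using step_eq_1[of "-t"] step_minus[of t] by simp

text \<open>\<open>step\<close> takes at an integer the mean of its one-sided limits, whereas the
  floor is continuous from the right. The constant -1 cancels in differences of floors, and the
  integer term becomes the jump of a coloring.\<close>

lemma double_floor_eq_step: "2 * \<lfloor>t\<rfloor> = step t + of_bool (t \<in> \<int>) - 1"
  by (cases "t \<in> \<int>") (auto simp: step_def ceiling_altdef elim!: Ints_cases, metis Ints_of_int)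

lemma no_integer_between_floor_ceiling:
  assumes "\<And>k::int. of_int k \<notin> closed_segment a (b::real)"
  shows "\<lfloor>a\<rfloor> = \<lfloor>b\<rfloor>" and "\<lceil>a\<rceil> = \<lceil>b\<rceil>"
proof -
  have *: "\<lfloor>x\<rfloor> = \<lfloor>y\<rfloor> \<and> \<lceil>x\<rceil> = \<lceil>y\<rceil>"
    if xy: "x \<le> y" and no: "\<And>k::int. of_int k \<notin> {x..y}" for x y :: real
  proof
    show "\<lfloor>x\<rfloor> = \<lfloor>y\<rfloor>"
      using no[of "\<lfloor>y\<rfloor>"] floor_mono[OF xy] by simp linarith
    show "\<lceil>x\<rceil> = \<lceil>y\<rceil>"
      using no[of "\<lceil>x\<rceil>"] ceiling_mono[OF xy] by simp linarith
  qed
  have "\<lfloor>a\<rfloor> = \<lfloor>b\<rfloor> \<and> \<lceil>a\<rceil> = \<lceil>b\<rceil>"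
  proof (cases "a \<le> b")
    case True
    then show ?thesis using *[OF True] assms by (simp add: closed_segment_eq_real_ivl)
  next
    case False
    then have "b \<le> a" by simp
    from *[OF this] False assms show ?thesis by (simp add: closed_segment_eq_real_ivl)
  qed
  then show "\<lfloor>a\<rfloor> = \<lfloor>b\<rfloor>" and "\<lceil>a\<rceil> = \<lceil>b\<rceil>" by blast+
qed

lemma no_integer_between_step:
  assumes "\<And>k::int. of_int k \<notin> closed_segment a b"
  shows "step a = step b"
  using no_integer_between_floor_ceiling[OF assms] by (simp add: step_def)

text \<open>If the four endpoints are distinct modulo 1, this is 2 or -2 when the chords (a, b) and
  (c, d) alternate on the circle and 0 otherwise: twice the intersection number of the
  chords.\<close>

definition linking :: "real \<Rightarrow> real \<Rightarrow> real \<Rightarrow> real \<Rightarrow> int" where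
  "linking a b c d = step (a - d) + step (b - c) - step (a - c) - step (b - d)"

lemma linking_antisym: "linking a b c d = - linking c d a b"
  unfolding linking_def
  using step_diff_commute[of a d] step_diff_commute[of b c] step_diff_commute[of a c]
    step_diff_commute[of b d]
  by simp

lemma linking_self [simp]: "linking a b a b = 0"
  using linking_antisym[of a b a b] by simp

text \<open>Each argument occurs in two terms of opposite sign, and a shift by an integer changes
  both by the same amount.\<close>

lemma linking_cong_Ints_right:
  assumes "c - c' \<in> \<int>" "d - d' \<in> \<int>"
  shows "linking a b c d = linking a b c' d'"
proof -
  obtain k m where km: "c - c' = of_int k" "d - d' = of_int m"
    using assms by (auto elim!: Ints_cases)
  have "step (x - c') = step (x - c) + 2 * k" "step (x - d') = step (x - d) + 2 * m" for x
    using step_add_of_int[of "x - c" k] step_add_of_int[of "x - d" m] km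
    by (simp_all add: algebra_simps)
  then show ?thesis by (simp add: linking_def)
qed

lemma linking_cong_Ints:
  assumes "a - a' \<in> \<int>" "b - b' \<in> \<int>" "c - c' \<in> \<int>" "d - d' \<in> \<int>"
  shows "linking a b c d = linking a' b' c' d'"
  using linking_cong_Ints_right[OF assms(1,2), of c d] linking_cong_Ints_right[OF assms(3,4), of a' b']
    linking_antisym[of c d a b] linking_antisym[of c d a' b'] by simp

section \<open>Double points of a generic curve and their parameters\<close>

lemma cross_self [simp]: "cross a a = 0"
  by (simp add: cross_def)

lemma cross_commute: "cross a b = - cross b a"
  by (simp add: cross_def)

lemma cross_scaleR [simp]: "cross (x *\<^sub>R a) b = x * cross a b" "cross a (x *\<^sub>R b) = x * cross a b"
  by (simp_all add: cross_def algebra_simps)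

lemma generic_closed_curveD:
  assumes "generic_closed_curve K"
  shows "\<forall>u. curve K (u + 1) = curve K u" "curve K C1_differentiable_on UNIV"
    "finite (double_points K)"
    "\<forall>u v. curve K u = curve K v \<and> u - v \<notin> \<int> \<longrightarrow> cross (velocity K u) (velocity K v) \<noteq> 0"
    "\<forall>u v w. curve K u = curve K v \<and> curve K v = curve K w \<longrightarrow>
        u - v \<in> \<int> \<or> v - w \<in> \<int> \<or> u - w \<in> \<int>"
  using assms unfolding generic_closed_curve_def by - (elim conjE, assumption)+

lemma has_velocity:
  assumes "generic_closed_curve K"
  shows "(curve K has_vector_derivative velocity K u) (at u)"
  using generic_closed_curveD(2)[OF assms]
  by (simp add: C1_differentiable_on_eq vector_derivative_works)

lemma isCont_curve:
  assumes "generic_closed_curve K"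
  shows "isCont (curve K) u"
  using has_vector_derivative_continuous[OF has_velocity[OF assms]] .

lemma periodic_int:
  assumes "\<And>u::real. f (u + 1) = f u"
  shows "f (u + of_int k) = f u"
proof (induction k rule: int_induct[of _ 0])
  case (step1 i) then show ?case using assms[of "u + of_int i"] by (simp add: add.assoc)
next
  case (step2 i) then show ?case using assms[of "u + of_int i - 1"] by (simp add: algebra_simps)
qed simp

lemma periodic_Ints:
  assumes "\<And>u::real. f (u + 1) = f u" "u - v \<in> \<int>"
  shows "f u = f v"
proof -
  obtain k where "u - v = of_int k" using assms(2) by (auto elim: Ints_cases)
  then have "u = v + of_int k" by simp
  then show ?thesis using periodic_int[of f v k, OF assms(1)] by simp
qed

lemma curve_Ints:
  assumes "generic_closed_curve K" "u - v \<in> \<int>"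
  shows "curve K u = curve K v"
  by (rule periodic_Ints[of "curve K", OF _ assms(2)]) (simp add: generic_closed_curveD(1)[OF assms(1)])

lemma velocity_Ints:
  assumes "generic_closed_curve K" "u - v \<in> \<int>"
  shows "velocity K u = velocity K v"
proof (rule periodic_Ints[OF _ assms(2)])
  fix u
  have "((\<lambda>x. x + 1) has_vector_derivative 1) (at u)"
    by (auto intro!: derivative_eq_intros)
  then have "(curve K \<circ> (\<lambda>x. x + 1) has_vector_derivative (1 *\<^sub>R velocity K (u + 1))) (at u)"
    by (rule vector_diff_chain_at) (rule has_velocity[OF assms(1)])
  moreover have "curve K \<circ> (\<lambda>x. x + 1) = curve K"
    by (simp add: fun_eq_iff generic_closed_curveD(1)[OF assms(1)])
  ultimately have "(curve K has_vector_derivative velocity K (u + 1)) (at u)" by simp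
  then show "velocity K (u + 1) = velocity K u" by (rule vector_derivative_at[symmetric])
qed

lemma Ints_diff_commute: "a - b \<in> \<int> \<longleftrightarrow> b - a \<in> \<int>" for a b :: "'a::ring_1"
  using Ints_minus[of "a - b"] Ints_minus[of "b - a"] by auto

text \<open>Keeps the left and the right incoming strand together as an ordered pair, which is what
  an oriented chord needs.\<close>

definition crossing_at :: "vdiagram \<Rightarrow> complex \<Rightarrow> real \<Rightarrow> real \<Rightarrow> bool" where
  "crossing_at K p l r \<longleftrightarrow>
     curve K l = p \<and> curve K r = p \<and> cross (velocity K l) (velocity K r) > 0"

lemma left_incoming_eq: "left_incoming K p = {l. \<exists>r. crossing_at K p l r}"
  by (auto simp: left_incoming_def crossing_at_def)

lemma right_incoming_eq: "right_incoming K p = {r. \<exists>l. crossing_at K p l r}"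
  by (auto simp: right_incoming_def crossing_at_def)

lemma crossing_at_not_Ints:
  assumes "generic_closed_curve K" "crossing_at K p l r"
  shows "l - r \<notin> \<int>"
proof
  assume "l - r \<in> \<int>"
  from velocity_Ints[OF assms(1) this] assms(2) show False by (simp add: crossing_at_def)
qed

lemma double_point_cases:
  assumes "generic_closed_curve K" "curve K u = p" "curve K v = p" "u - v \<notin> \<int>" "curve K w = p"
  shows "w - u \<in> \<int> \<or> w - v \<in> \<int>"
proof -
  have "curve K u = curve K v \<and> curve K v = curve K w" using assms by simp
  with generic_closed_curveD(5)[OF assms(1)] have "u - v \<in> \<int> \<or> v - w \<in> \<int> \<or> u - w \<in> \<int>"
    by blast
  then show ?thesis using assms(4) Ints_diff_commute by blast
qed

lemma crossing_at_cong_Ints: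
  assumes "generic_closed_curve K" "crossing_at K p l r" "l' - l \<in> \<int>" "r' - r \<in> \<int>"
  shows "crossing_at K p l' r'"
  using assms(2) unfolding crossing_at_def
    curve_Ints[OF assms(1,3)] curve_Ints[OF assms(1,4)]
    velocity_Ints[OF assms(1,3)] velocity_Ints[OF assms(1,4)] .

text \<open>A double point has only two parameters modulo integers, and exchanging them would
  reverse the sign of \<open>cross\<close>.\<close>

lemma crossing_at_unique:
  assumes K: "generic_closed_curve K" and lr: "crossing_at K p l r" and lr': "crossing_at K p l' r'"
  shows "l' - l \<in> \<int>" "r' - r \<in> \<int>"
proof -
  have p: "curve K l = p" "curve K r = p" "curve K l' = p" "curve K r' = p"
    using lr lr' by (auto simp: crossing_at_def)
  note nI = crossing_at_not_Ints[OF K lr] crossing_at_not_Ints[OF K lr']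
  note cl = double_point_cases[OF K p(1,2) nI(1) p(3)]
  note cr = double_point_cases[OF K p(1,2) nI(1) p(4)]
  have False if "l' - r \<in> \<int>" "r' - l \<in> \<int>"
    using lr lr' cross_commute[of "velocity K l" "velocity K r"]
    unfolding crossing_at_def velocity_Ints[OF K that(1)] velocity_Ints[OF K that(2)] by linarith
  moreover have False if "l' - r \<in> \<int>" "r' - r \<in> \<int>"
    using Ints_diff[OF that] nI by simp
  moreover have False if "l' - l \<in> \<int>" "r' - l \<in> \<int>"
    using Ints_diff[OF that] nI by simp
  ultimately show "l' - l \<in> \<int>" "r' - r \<in> \<int>" using cl cr by blast+
qed

lemma mem_left_incoming_iff:
  assumes "generic_closed_curve K" "crossing_at K p l r"
  shows "u \<in> left_incoming K p \<longleftrightarrow> u - l \<in> \<int>"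
proof
  assume "u \<in> left_incoming K p"
  then obtain r' where "crossing_at K p u r'" by (auto simp: left_incoming_eq)
  then show "u - l \<in> \<int>" using crossing_at_unique(1)[OF assms] by blast
next
  assume "u - l \<in> \<int>"
  then have "crossing_at K p u r" using crossing_at_cong_Ints[OF assms] by simp
  then show "u \<in> left_incoming K p" by (auto simp: left_incoming_eq)
qed

lemma mem_right_incoming_iff:
  assumes "generic_closed_curve K" "crossing_at K p l r"
  shows "u \<in> right_incoming K p \<longleftrightarrow> u - r \<in> \<int>"
proof
  assume "u \<in> right_incoming K p"
  then obtain l' where "crossing_at K p l' u" by (auto simp: right_incoming_eq)
  then show "u - r \<in> \<int>" using crossing_at_unique(2)[OF assms] by blast
next
  assume "u - r \<in> \<int>"
  then have "crossing_at K p l u" using crossing_at_cong_Ints[OF assms] by simp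
  then show "u \<in> right_incoming K p" by (auto simp: right_incoming_eq)
qed

lemma crossing_at_iff:
  assumes "generic_closed_curve K" "crossing_at K p l r"
  shows "crossing_at K p l' r' \<longleftrightarrow> l' - l \<in> \<int> \<and> r' - r \<in> \<int>"
  using crossing_at_unique[OF assms] crossing_at_cong_Ints[OF assms] by blast

lemma double_point_crossing_at:
  assumes "generic_closed_curve K" "p \<in> double_points K"
  obtains l r where "crossing_at K p l r"
proof -
  obtain u v where uv: "curve K u = p" "curve K v = p" "u - v \<notin> \<int>"
    using assms(2) by (auto simp: double_points_def)
  then have "cross (velocity K u) (velocity K v) \<noteq> 0"
    using generic_closed_curveD(4)[OF assms(1)] by simp
  then have "crossing_at K p u v \<or> crossing_at K p v u"
    unfolding crossing_at_def using uv cross_commute[of "velocity K u" "velocity K v"] by linarith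
  then show ?thesis using that by blast
qed

text \<open>An arbitrary lift of a point of the circle; it is meaningful only at double points, and
  the linking numbers do not depend on the choice.\<close>

definition left_param :: "vdiagram \<Rightarrow> complex \<Rightarrow> real" where
  "left_param K p = (SOME l. l \<in> left_incoming K p)"

definition right_param :: "vdiagram \<Rightarrow> complex \<Rightarrow> real" where
  "right_param K p = (SOME r. r \<in> right_incoming K p)"

lemma crossing_at_params:
  assumes "generic_closed_curve K" "p \<in> double_points K"
  shows "crossing_at K p (left_param K p) (right_param K p)"
proof -
  obtain l r where lr: "crossing_at K p l r" using double_point_crossing_at[OF assms] .
  have "left_param K p \<in> left_incoming K p"
    unfolding left_param_def by (rule someI[of _ l]) (use lr in \<open>auto simp: left_incoming_eq\<close>)
  moreover have "right_param K p \<in> right_incoming K p"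
    unfolding right_param_def by (rule someI[of _ r]) (use lr in \<open>auto simp: right_incoming_eq\<close>)
  ultimately show ?thesis
    using mem_left_incoming_iff[OF assms(1) lr] mem_right_incoming_iff[OF assms(1) lr]
      crossing_at_iff[OF assms(1) lr] by blast
qed

section \<open>Over and under parameters of a diagram\<close>

lemma singular_imp_generic: "singular_knot_diagram K \<Longrightarrow> generic_closed_curve K"
  by (simp add: singular_knot_diagram_def)

lemma virtual_imp_singular: "virtual_knot_diagram K \<Longrightarrow> singular_knot_diagram K"
  by (simp add: virtual_knot_diagram_def)

lemma classical_crossings_subset:
  "singular_knot_diagram K \<Longrightarrow> classical_crossings K \<subseteq> double_points K"
  by (simp add: singular_knot_diagram_def classical_crossings_def)

lemma finite_classical_crossings:
  "singular_knot_diagram K \<Longrightarrow> finite (classical_crossings K)"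
  by (rule finite_subset[OF classical_crossings_subset generic_closed_curveD(3)[OF singular_imp_generic]])

lemma singular_knot_diagramD:
  assumes "singular_knot_diagram K"
  shows "\<forall>u. u + 1 \<in> over K \<longleftrightarrow> u \<in> over K" "\<forall>u. u + 1 \<in> under K \<longleftrightarrow> u \<in> under K"
    "over K \<inter> under K = {}"
    "\<forall>u v. curve K u = curve K v \<and> u - v \<notin> \<int> \<longrightarrow> (u \<in> over K \<longleftrightarrow> v \<in> under K)"
    "nodes K \<subseteq> double_points K" "nodes K \<inter> classical_crossings K = {}"
  using assms unfolding singular_knot_diagram_def classical_crossings_def
  by - (elim conjE, assumption)+

lemma over_Ints:
  assumes "singular_knot_diagram K" "u - v \<in> \<int>"
  shows "u \<in> over K \<longleftrightarrow> v \<in> over K"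
  using periodic_Ints[of "\<lambda>w. w \<in> over K", OF _ assms(2)] singular_knot_diagramD(1)[OF assms(1)]
  by simp

lemma under_Ints:
  assumes "singular_knot_diagram K" "u - v \<in> \<int>"
  shows "u \<in> under K \<longleftrightarrow> v \<in> under K"
  using periodic_Ints[of "\<lambda>w. w \<in> under K", OF _ assms(2)] singular_knot_diagramD(2)[OF assms(1)]
  by simp

lemma over_iff_under:
  assumes "singular_knot_diagram K" "curve K u = curve K v" "u - v \<notin> \<int>"
  shows "u \<in> over K \<longleftrightarrow> v \<in> under K"
  using singular_knot_diagramD(4)[OF assms(1)] assms(2,3) by simp

text \<open>At a double point one strand is over exactly if the other is under, so being a crossing
  parameter depends only on the point of the plane.\<close>

lemma crossing_param_iff:
  assumes "singular_knot_diagram K"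
  shows "u \<in> over K \<union> under K \<longleftrightarrow> curve K u \<in> classical_crossings K"
proof
  assume "curve K u \<in> classical_crossings K"
  then obtain w where w: "curve K u = curve K w" "w \<in> over K \<union> under K"
    by (auto simp: classical_crossings_def)
  show "u \<in> over K \<union> under K"
  proof (cases "u - w \<in> \<int>")
    case True
    then show ?thesis using w(2) over_Ints[OF assms True] under_Ints[OF assms True] by blast
  next
    case False
    then have "w - u \<notin> \<int>" using Ints_diff_commute by blast
    then show ?thesis
      using w(2) over_iff_under[OF assms w(1) False] over_iff_under[OF assms w(1)[symmetric]] by blast
  qed
qed (auto simp: classical_crossings_def)

lemma crossing_sign_eq:
  assumes "singular_knot_diagram K" "crossing_at K p l r"
  shows "crossing_sign K p = (if l \<in> over K then 1 else -1)"
  using mem_left_incoming_iff[OF singular_imp_generic[OF assms(1)] assms(2)]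
    over_Ints[OF assms(1), of _ l]
  unfolding crossing_sign_def by (metis Ints_0 diff_self)

lemma crossing_param_cases:
  assumes "singular_knot_diagram K" "u \<in> over K \<union> under K"
  shows "u - left_param K (curve K u) \<in> \<int> \<or> u - right_param K (curve K u) \<in> \<int>"
proof -
  let ?p = "curve K u"
  have K: "generic_closed_curve K" by (rule singular_imp_generic[OF assms(1)])
  have "?p \<in> double_points K"
    using assms(2) crossing_param_iff[OF assms(1)] classical_crossings_subset[OF assms(1)] by blast
  note lr = crossing_at_params[OF K this]
  show ?thesis
    using double_point_cases[OF K _ _ crossing_at_not_Ints[OF K lr] refl] lr
    by (simp add: crossing_at_def)
qed

section \<open>Cheng colorings\<close>

lemma in_label_eqI:
  assumes "eventually (\<lambda>w. f w = y) (at_left u)"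
  shows "in_label f u = y"
  unfolding in_label_def by (rule tendsto_Lim[OF _ tendsto_eventually[OF assms]]) simp

lemma out_label_eqI:
  assumes "eventually (\<lambda>w. f w = y) (at_right u)"
  shows "out_label f u = y"
  unfolding out_label_def by (rule tendsto_Lim[OF _ tendsto_eventually[OF assms]]) simp

lemma eventually_at_right_floor:
  "eventually (\<lambda>w::real. \<lfloor>w - x\<rfloor> = \<lfloor>u - x\<rfloor> \<and> w - x \<notin> \<int>) (at_right u)"
  unfolding eventually_at_right_field
proof (intro exI[of _ "x + of_int \<lfloor>u - x\<rfloor> + 1"] conjI allI impI)
  fix w assume w: "u < w" "w < x + of_int \<lfloor>u - x\<rfloor> + 1"
  show fl: "\<lfloor>w - x\<rfloor> = \<lfloor>u - x\<rfloor>" using w by linarith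
  show "w - x \<notin> \<int>"
  proof
    assume "w - x \<in> \<int>"
    then have "of_int \<lfloor>w - x\<rfloor> = w - x" by (auto elim: Ints_cases)
    then show False using fl w by linarith
  qed
qed linarith

text \<open>The left limit of the floor is \<open>\<lceil>u - x\<rceil> - 1\<close> in both cases:
  one below the value at an integer, and the value itself elsewhere.\<close>

lemma eventually_at_left_floor:
  "eventually (\<lambda>w::real. \<lfloor>w - x\<rfloor> = \<lceil>u - x\<rceil> - 1 \<and> w - x \<notin> \<int>) (at_left u)"
  unfolding eventually_at_left_field
proof (intro exI[of _ "x + of_int \<lceil>u - x\<rceil> - 1"] conjI allI impI)
  fix w assume w: "x + of_int \<lceil>u - x\<rceil> - 1 < w" "w < u"
  show fl: "\<lfloor>w - x\<rfloor> = \<lceil>u - x\<rceil> - 1" using w by linarith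
  show "w - x \<notin> \<int>"
  proof
    assume "w - x \<in> \<int>"
    then have "of_int \<lfloor>w - x\<rfloor> = w - x" by (auto elim: Ints_cases)
    then show False using fl w by linarith
  qed
qed linarith

text \<open>The crossing parameters lie in finitely many translates of the integers, hence do not
  accumulate.\<close>

lemma eventually_not_crossing_param:
  assumes "singular_knot_diagram K"
  shows "eventually (\<lambda>w. w \<notin> over K \<union> under K) (at u)"
proof -
  have "eventually (\<lambda>w. w - x \<notin> \<int>) (at u)" for x
    unfolding eventually_at_split
    by (intro conjI eventually_mono[OF eventually_at_right_floor[of x u]]
        eventually_mono[OF eventually_at_left_floor[of x u]]) simp_all
  then have "eventually (\<lambda>w. \<forall>d\<in>classical_crossings K.
      w - left_param K d \<notin> \<int> \<and> w - right_param K d \<notin> \<int>) (at u)"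
    using finite_classical_crossings[OF assms]
    by (intro eventually_ball_finite ballI eventually_conj) auto
  then show ?thesis
  proof (rule eventually_mono)
    fix w
    assume *: "\<forall>d\<in>classical_crossings K. w - left_param K d \<notin> \<int> \<and> w - right_param K d \<notin> \<int>"
    show "w \<notin> over K \<union> under K"
      using * crossing_param_cases[OF assms, of w] crossing_param_iff[OF assms, of w] by blast
  qed
qed

lemma cheng_coloringD:
  assumes "cheng_coloring K f"
  shows "\<forall>u v. u \<le> v \<and> {u..v} \<inter> (over K \<union> under K) = {} \<longrightarrow> f u = f v"
    "\<forall>c \<in> classical_crossings K.
        (\<forall>u \<in> left_incoming K c. out_label f u = in_label f u - 1) \<and>
        (\<forall>v \<in> right_incoming K c. out_label f v = in_label f v + 1)"
  using assms unfolding cheng_coloring_def by - (elim conjE, assumption)+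

text \<open>The clause on \<open>out_label f w\<close> makes the outgoing label itself constant to
  the right of \<open>u\<close>; this is the function that the uniqueness proof compares.\<close>

lemma coloring_right_limit:
  assumes "singular_knot_diagram K" "cheng_coloring K f"
  obtains b where "u < b" "\<And>w. u < w \<Longrightarrow> w < b \<Longrightarrow> f w = out_label f u \<and> out_label f w = out_label f u"
proof -
  have "eventually (\<lambda>w. w \<notin> over K \<union> under K) (at_right u)"
    using eventually_not_crossing_param[OF assms(1), of u] by (simp add: eventually_at_split)
  then obtain b where b: "u < b" "\<And>w. u < w \<Longrightarrow> w < b \<Longrightarrow> w \<notin> over K \<union> under K"
    unfolding eventually_at_right_field by blast
  define y where "y = f ((u + b) / 2)"
  have const: "f v = f w" if "v \<le> w" "u < v" "w < b" for v w
  proof -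
    have "{v..w} \<inter> (over K \<union> under K) = {}" using b(2) that(2,3)
      by (meson IntE atLeastAtMost_iff disjoint_iff le_less_trans less_le_trans)
    then show ?thesis using cheng_coloringD(1)[OF assms(2)] that(1) by blast
  qed
  have fy: "f w = y" if "u < w" "w < b" for w
  proof (cases "w \<le> (u + b) / 2")
    case True
    then show ?thesis unfolding y_def by (rule const) (use that in simp_all)
  next
    case False
    have "f ((u + b) / 2) = f w" by (rule const) (use False that in simp_all)
    then show ?thesis by (simp add: y_def)
  qed
  have out: "out_label f w = y" if "u \<le> w" "w < b" for w
  proof (rule out_label_eqI)
    show "eventually (\<lambda>w. f w = y) (at_right w)"
      unfolding eventually_at_right_field using that fy by (intro exI[of _ b]) auto
  qed
  have "f w = out_label f u \<and> out_label f w = out_label f u" if "u < w" "w < b" for w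
    using fy[OF that] out[of w] out[of u] that b(1) by simp
  then show ?thesis by (rule that[OF b(1)])
qed

lemma coloring_left_limit:
  assumes "singular_knot_diagram K" "cheng_coloring K f"
  obtains a where "a < u" "\<And>w. a < w \<Longrightarrow> w < u \<Longrightarrow> f w = in_label f u \<and> out_label f w = in_label f u"
proof -
  have "eventually (\<lambda>w. w \<notin> over K \<union> under K) (at_left u)"
    using eventually_not_crossing_param[OF assms(1), of u] by (simp add: eventually_at_split)
  then obtain a where a: "a < u" "\<And>w. a < w \<Longrightarrow> w < u \<Longrightarrow> w \<notin> over K \<union> under K"
    unfolding eventually_at_left_field by blast
  define y where "y = f ((a + u) / 2)"
  have const: "f v = f w" if "v \<le> w" "a < v" "w < u" for v w
  proof -
    have "{v..w} \<inter> (over K \<union> under K) = {}" using a(2) that(2,3)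
      by (meson IntE atLeastAtMost_iff disjoint_iff le_less_trans less_le_trans)
    then show ?thesis using cheng_coloringD(1)[OF assms(2)] that(1) by blast
  qed
  have fy: "f w = y" if "a < w" "w < u" for w
  proof (cases "w \<le> (a + u) / 2")
    case True
    then show ?thesis unfolding y_def by (rule const) (use that in simp_all)
  next
    case False
    have "f ((a + u) / 2) = f w" by (rule const) (use False that in simp_all)
    then show ?thesis by (simp add: y_def)
  qed
  have out: "out_label f w = y" if "a < w" "w < u" for w
  proof (rule out_label_eqI)
    show "eventually (\<lambda>w. f w = y) (at_right w)"
      unfolding eventually_at_right_field using that fy by (intro exI[of _ u]) auto
  qed
  have "in_label f u = y"
  proof (rule in_label_eqI)
    show "eventually (\<lambda>w. f w = y) (at_left u)"
      unfolding eventually_at_left_field using a(1) fy by (intro exI[of _ a]) auto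
  qed
  then have "f w = in_label f u \<and> out_label f w = in_label f u" if "a < w" "w < u" for w
    using fy[OF that] out[OF that] by simp
  then show ?thesis by (rule that[OF a(1)])
qed

lemma coloring_no_jump:
  assumes "singular_knot_diagram K" "cheng_coloring K f" "u \<notin> over K \<union> under K"
  shows "out_label f u = in_label f u"
proof -
  obtain b where b: "u < b" "\<And>w. u < w \<Longrightarrow> w < b \<Longrightarrow> f w = out_label f u"
    using coloring_right_limit[OF assms(1,2), of u] by metis
  obtain a where a: "a < u" "\<And>w. a < w \<Longrightarrow> w < u \<Longrightarrow> f w = in_label f u"
    using coloring_left_limit[OF assms(1,2), of u] by metis
  from eventually_not_crossing_param[OF assms(1), of u]
  obtain d where d: "d > 0" "\<And>w. w \<noteq> u \<Longrightarrow> \<bar>w - u\<bar> < d \<Longrightarrow> w \<notin> over K \<union> under K"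
    unfolding eventually_at dist_real_def by auto
  \<comment> \<open>Small enough that both \<open>u - e\<close> and \<open>u + e\<close> lie where
    \<open>f\<close> equals its one-sided limit at \<open>u\<close>, and that no crossing parameter
    lies between them.\<close>
  define e where "e = min d (min (b - u) (u - a)) / 2"
  have e: "0 < e" "e < d" "u + e < b" "a < u - e" using a(1) b(1) d(1) by (auto simp: e_def min_def field_simps)
  have "w \<notin> over K \<union> under K" if "w \<in> {u - e..u + e}" for w
  proof (cases "w = u")
    case False
    have "\<bar>w - u\<bar> < d" using that e(1,2) by (auto simp: abs_le_iff abs_less_iff)
    with False d(2) show ?thesis by blast
  qed (use assms(3) in simp)
  then have "{u - e..u + e} \<inter> (over K \<union> under K) = {}" by blast
  moreover have "u - e \<le> u + e" using e by simp
  ultimately have "f (u - e) = f (u + e)"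
    using cheng_coloringD(1)[OF assms(2)] by blast
  then show ?thesis using a(2)[of "u - e"] b(2)[of "u + e"] e by simp
qed

text \<open>The diagram alone prescribes the jump: -1 on a left incoming strand, +1 on a right
  incoming one, and 0 away from crossings.\<close>

lemma coloring_jump_unique:
  assumes "singular_knot_diagram K" "cheng_coloring K f" "cheng_coloring K g"
  shows "out_label f u - in_label f u = out_label g u - in_label g u"
proof (cases "u \<in> over K \<union> under K")
  case False
  then show ?thesis using coloring_no_jump[OF assms(1,2)] coloring_no_jump[OF assms(1,3)] by simp
next
  case True
  let ?p = "curve K u"
  have K: "generic_closed_curve K" by (rule singular_imp_generic[OF assms(1)])
  have p: "?p \<in> classical_crossings K" using True crossing_param_iff[OF assms(1)] by blast
  then have lr: "crossing_at K ?p (left_param K ?p) (right_param K ?p)"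
    using crossing_at_params[OF K] classical_crossings_subset[OF assms(1)] by blast
  have "u \<in> left_incoming K ?p \<or> u \<in> right_incoming K ?p"
    using crossing_param_cases[OF assms(1) True] mem_left_incoming_iff[OF K lr]
      mem_right_incoming_iff[OF K lr] by blast
  then show ?thesis
  proof
    assume l: "u \<in> left_incoming K ?p"
    have "out_label h u = in_label h u - 1" if "cheng_coloring K h" for h
      using cheng_coloringD(2)[OF that] p l by blast
    then show ?thesis using assms by simp
  next
    assume r: "u \<in> right_incoming K ?p"
    have "out_label h u = in_label h u + 1" if "cheng_coloring K h" for h
      using cheng_coloringD(2)[OF that] p r by blast
    then show ?thesis using assms by simp
  qed
qed

text \<open>The difference of the outgoing labels is locally constant: on the right by the one-sided
  limits, on the left because both colorings jump equally. Connectedness of the line does the rest.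
  Outgoing labels are used because the values of a coloring at crossing parameters are
  arbitrary.\<close>

lemma coloring_unique:
  assumes "singular_knot_diagram K" "cheng_coloring K f" "cheng_coloring K g"
  obtains k where "\<And>u. out_label f u = out_label g u + k"
proof -
  define h where "h u = out_label f u - out_label g u" for u
  have "eventually (\<lambda>w. h u = h w) (at u)" for u
    unfolding eventually_at_split
  proof
    obtain a where a: "a < u" "\<And>w. a < w \<Longrightarrow> w < u \<Longrightarrow> out_label f w = in_label f u"
      using coloring_left_limit[OF assms(1,2), of u] by metis
    obtain a' where a': "a' < u" "\<And>w. a' < w \<Longrightarrow> w < u \<Longrightarrow> out_label g w = in_label g u"
      using coloring_left_limit[OF assms(1,3), of u] by metis
    show "eventually (\<lambda>w. h u = h w) (at_left u)"
      unfolding eventually_at_left_field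
      using a a' coloring_jump_unique[OF assms, of u]
      by (intro exI[of _ "max a a'"]) (auto simp: h_def)
    obtain b where b: "u < b" "\<And>w. u < w \<Longrightarrow> w < b \<Longrightarrow> out_label f w = out_label f u"
      using coloring_right_limit[OF assms(1,2), of u] by metis
    obtain b' where b': "u < b'" "\<And>w. u < w \<Longrightarrow> w < b' \<Longrightarrow> out_label g w = out_label g u"
      using coloring_right_limit[OF assms(1,3), of u] by metis
    show "eventually (\<lambda>w. h u = h w) (at_right u)"
      unfolding eventually_at_right_field
      using b b' by (intro exI[of _ "min b b'"]) (auto simp: h_def)
  qed
  then have "h u = h 0" for u
    using connected_local_const[of "UNIV :: real set" u 0 h] by auto
  then show ?thesis using that[of "h 0"] by (metis add.commute diff_add_cancel h_def)
qed

section \<open>An explicit coloring\<close>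

definition standard_coloring :: "vdiagram \<Rightarrow> real \<Rightarrow> int" where
  "standard_coloring K u =
     (\<Sum>d\<in>classical_crossings K. \<lfloor>u - right_param K d\<rfloor> - \<lfloor>u - left_param K d\<rfloor>)"

text \<open>A single floor is not periodic; pairing one right with one left parameter in each
  summand is what cancels the shift.\<close>

lemma standard_coloring_Ints:
  assumes "u - v \<in> \<int>"
  shows "standard_coloring K u = standard_coloring K v"
proof -
  obtain k where k: "u = v + of_int k" using assms by (auto elim!: Ints_cases simp: algebra_simps)
  have "\<lfloor>v + of_int k - x\<rfloor> = \<lfloor>v - x\<rfloor> + k" for x
    using floor_add_int[of "v - x" k] by (simp add: algebra_simps)
  then show ?thesis by (simp add: standard_coloring_def k)
qed

text \<open>Floors are continuous from the right, so the value at a parameter is already the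
  outgoing label.\<close>

lemma out_label_standard_coloring:
  assumes "singular_knot_diagram K"
  shows "out_label (standard_coloring K) u = standard_coloring K u"
proof (rule out_label_eqI)
  have "eventually (\<lambda>w. \<forall>d\<in>classical_crossings K. \<lfloor>w - right_param K d\<rfloor> = \<lfloor>u - right_param K d\<rfloor>
      \<and> \<lfloor>w - left_param K d\<rfloor> = \<lfloor>u - left_param K d\<rfloor>) (at_right u)"
    using finite_classical_crossings[OF assms] eventually_at_right_floor eventually_conj_iff
    by (intro eventually_ball_finite ballI) (auto simp: eventually_conj_iff)
  then show "eventually (\<lambda>w. standard_coloring K w = standard_coloring K u) (at_right u)"
    by (rule eventually_mono) (simp add: standard_coloring_def)
qed

definition jump :: "vdiagram \<Rightarrow> real \<Rightarrow> int" where
  "jump K u = (\<Sum>d\<in>classical_crossings K.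
     of_bool (u - right_param K d \<in> \<int>) - of_bool (u - left_param K d \<in> \<int>))"

lemma in_label_standard_coloring:
  assumes "singular_knot_diagram K"
  shows "in_label (standard_coloring K) u = standard_coloring K u - jump K u"
proof (rule in_label_eqI)
  have fl: "\<lceil>t\<rceil> - 1 = \<lfloor>t\<rfloor> - of_bool (t \<in> \<int>)" for t :: real
    using double_floor_eq_step[of t] by (simp add: step_def)
  have "eventually (\<lambda>w. \<forall>d\<in>classical_crossings K. \<lfloor>w - right_param K d\<rfloor> = \<lceil>u - right_param K d\<rceil> - 1
      \<and> \<lfloor>w - left_param K d\<rfloor> = \<lceil>u - left_param K d\<rceil> - 1) (at_left u)"
    using finite_classical_crossings[OF assms] eventually_at_left_floor eventually_conj_iff
    by (intro eventually_ball_finite ballI) (auto simp: eventually_conj_iff)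
  then show "eventually (\<lambda>w. standard_coloring K w = standard_coloring K u - jump K u) (at_left u)"
  proof (rule eventually_mono)
    fix w
    assume "\<forall>d\<in>classical_crossings K. \<lfloor>w - right_param K d\<rfloor> = \<lceil>u - right_param K d\<rceil> - 1
      \<and> \<lfloor>w - left_param K d\<rfloor> = \<lceil>u - left_param K d\<rceil> - 1"
    then show "standard_coloring K w = standard_coloring K u - jump K u"
      by (simp add: standard_coloring_def jump_def fl sum_subtractf)
  qed
qed

lemma classical_crossing_at:
  assumes "singular_knot_diagram K" "p \<in> classical_crossings K"
  shows "crossing_at K p (left_param K p) (right_param K p)"
  using crossing_at_params[OF singular_imp_generic[OF assms(1)]]
    classical_crossings_subset[OF assms(1)] assms(2) by blast

text \<open>Parameters congruent modulo integers give the same point, and at one point the left and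
  the right strand are not congruent. Hence exactly one summand of \<open>jump\<close> survives at a
  crossing parameter.\<close>

lemma crossing_at_param_Ints_iff:
  assumes "singular_knot_diagram K" "p \<in> classical_crossings K" "d \<in> classical_crossings K"
    and lr: "crossing_at K p l r"
  shows "l - left_param K d \<in> \<int> \<longleftrightarrow> d = p" "r - right_param K d \<in> \<int> \<longleftrightarrow> d = p"
    "l - right_param K d \<notin> \<int>" "r - left_param K d \<notin> \<int>"
proof -
  have K: "generic_closed_curve K" by (rule singular_imp_generic[OF assms(1)])
  note d = classical_crossing_at[OF assms(1,3)]
  have eq: "d = p" if "x - y \<in> \<int>" "x = l \<or> x = r" "y = left_param K d \<or> y = right_param K d" for x y
    using curve_Ints[OF K that(1)] that(2,3) lr d by (auto simp: crossing_at_def)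
  note un = crossing_at_unique[OF K d, of l r]
  show "l - left_param K d \<in> \<int> \<longleftrightarrow> d = p" "r - right_param K d \<in> \<int> \<longleftrightarrow> d = p"
    using eq un lr by blast+
  note nI = crossing_at_not_Ints[OF K lr]
  show "l - right_param K d \<notin> \<int>"
  proof
    assume *: "l - right_param K d \<in> \<int>"
    then have "r - right_param K d \<in> \<int>" using eq un lr by blast
    from Ints_diff[OF * this] nI show False by simp
  qed
  show "r - left_param K d \<notin> \<int>"
  proof
    assume *: "r - left_param K d \<in> \<int>"
    then have "l - left_param K d \<in> \<int>" using eq un lr by blast
    from Ints_diff[OF this *] nI show False by simp
  qed
qed

lemma jump_eq:
  assumes K: "singular_knot_diagram K" and p: "p \<in> classical_crossings K" and lr: "crossing_at K p l r"
  shows "jump K l = -1" "jump K r = 1"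
proof -
  note * = crossing_at_param_Ints_iff[OF K p _ lr]
  have "jump K l = (\<Sum>d\<in>classical_crossings K. if d = p then -1 else 0)"
    unfolding jump_def by (rule sum.cong) (use * in auto)
  then show "jump K l = -1" using p finite_classical_crossings[OF K] by simp
  have "jump K r = (\<Sum>d\<in>classical_crossings K. if d = p then 1 else 0)"
    unfolding jump_def by (rule sum.cong) (use * in auto)
  then show "jump K r = 1" using p finite_classical_crossings[OF K] by simp
qed

lemma cheng_coloring_standard:
  assumes K: "singular_knot_diagram K"
  shows "cheng_coloring K (standard_coloring K)"
  unfolding cheng_coloring_def
proof (intro conjI allI impI ballI)
  show "standard_coloring K (u + 1) = standard_coloring K u" for u
    by (rule standard_coloring_Ints) simp
next
  fix u v :: real
  assume uv: "u \<le> v \<and> {u..v} \<inter> (over K \<union> under K) = {}"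
  have "\<lfloor>u - x\<rfloor> = \<lfloor>v - x\<rfloor>" if "\<And>w. w - x \<in> \<int> \<Longrightarrow> w \<in> over K \<union> under K" for x
  proof (rule no_integer_between_floor_ceiling(1))
    fix k :: int
    show "of_int k \<notin> closed_segment (u - x) (v - x)"
    proof
      assume "of_int k \<in> closed_segment (u - x) (v - x)"
      then have "x + of_int k \<in> {u..v}" using uv by (auto simp: closed_segment_eq_real_ivl)
      moreover have "x + of_int k \<in> over K \<union> under K" by (rule that) simp
      ultimately show False using uv by blast
    qed
  qed
  moreover have "w \<in> over K \<union> under K"
    if d: "d \<in> classical_crossings K" and w: "w - left_param K d \<in> \<int> \<or> w - right_param K d \<in> \<int>" for d w
  proof -
    have "curve K w = d"
      using w curve_Ints[OF singular_imp_generic[OF K], of w] classical_crossing_at[OF K d]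
      by (auto simp: crossing_at_def)
    then show ?thesis using d crossing_param_iff[OF K] by simp
  qed
  ultimately show "standard_coloring K u = standard_coloring K v"
    unfolding standard_coloring_def by (intro sum.cong refl arg_cong2[where f = "(-)"]) blast+
next
  fix c u assume c: "c \<in> classical_crossings K" and "u \<in> left_incoming K c"
  then obtain r where "crossing_at K c u r" by (auto simp: left_incoming_eq)
  from jump_eq(1)[OF K c this]
  show "out_label (standard_coloring K) u = in_label (standard_coloring K) u - 1"
    by (simp add: out_label_standard_coloring[OF K] in_label_standard_coloring[OF K])
next
  fix c u assume c: "c \<in> classical_crossings K" and "u \<in> right_incoming K c"
  then obtain l where "crossing_at K c l u" by (auto simp: right_incoming_eq)
  from jump_eq(2)[OF K c this]
  show "out_label (standard_coloring K) u = in_label (standard_coloring K) u + 1"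
    by (simp add: out_label_standard_coloring[OF K] in_label_standard_coloring[OF K])
qed

text \<open>The constant \<open>k\<close> cancels. Since the standard coloring records outgoing
  labels, the incoming label is one larger on the left strand and one smaller on the right strand;
  with the 1 subtracted in \<open>W_plus\<close> this leaves \<open>+ 1\<close>.\<close>

lemma W_plus_eq:
  assumes K: "singular_knot_diagram K" and f: "cheng_coloring K f" and p: "p \<in> classical_crossings K"
    and lr: "crossing_at K p l r"
  shows "W_plus K f p = standard_coloring K l - standard_coloring K r + 1"
proof -
  obtain k where k: "\<And>u. out_label f u = standard_coloring K u + k"
    using coloring_unique[OF K f cheng_coloring_standard[OF K]] out_label_standard_coloring[OF K] by metis
  note G = singular_imp_generic[OF K]
  have "in_label f u = standard_coloring K l + k + 1" if u: "u \<in> left_incoming K p" for u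
  proof -
    have "u - l \<in> \<int>" using u mem_left_incoming_iff[OF G lr] by simp
    moreover have "out_label f u = in_label f u - 1" using cheng_coloringD(2)[OF f] u p by blast
    ultimately show ?thesis using k[of u] standard_coloring_Ints[of u l K] by simp
  qed
  moreover have "l \<in> left_incoming K p" using lr by (auto simp: left_incoming_eq)
  ultimately have L: "left_label K f p = standard_coloring K l + k + 1"
    unfolding left_label_def by (intro the_equality) auto
  have "in_label f u = standard_coloring K r + k - 1" if u: "u \<in> right_incoming K p" for u
  proof -
    have "u - r \<in> \<int>" using u mem_right_incoming_iff[OF G lr] by simp
    moreover have "out_label f u = in_label f u + 1" using cheng_coloringD(2)[OF f] u p by blast
    ultimately show ?thesis using k[of u] standard_coloring_Ints[of u r K] by simp
  qed
  moreover have "r \<in> right_incoming K p" using lr by (auto simp: right_incoming_eq)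
  ultimately have "right_label K f p = standard_coloring K r + k - 1"
    unfolding right_label_def by (intro the_equality) auto
  with L show ?thesis by (simp add: W_plus_def)
qed

section \<open>Weights as sums of linking numbers\<close>

definition chord_linking :: "vdiagram \<Rightarrow> complex \<Rightarrow> complex \<Rightarrow> int" where
  "chord_linking K p d =
     linking (left_param K p) (right_param K p) (left_param K d) (right_param K d)"

definition chord_index :: "vdiagram \<Rightarrow> complex set \<Rightarrow> complex \<Rightarrow> int" where
  "chord_index K C p = (\<Sum>d\<in>C. chord_linking K p d)"

lemma chord_linking_eq:
  assumes K: "generic_closed_curve K" and lr: "crossing_at K p l r" "crossing_at K d l' r'"
  shows "chord_linking K p d = linking l r l' r'"
proof -
  have "left_param K c - x \<in> \<int> \<and> right_param K c - y \<in> \<int>" if xy: "crossing_at K c x y" for c x y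
  proof -
    have "c \<in> double_points K"
      using xy crossing_at_not_Ints[OF K xy] by (auto simp: double_points_def crossing_at_def)
    then show ?thesis using crossing_at_unique[OF K xy crossing_at_params[OF K]] by blast
  qed
  then show ?thesis
    unfolding chord_linking_def using lr by (intro linking_cong_Ints) auto
qed

lemma double_weight:
  assumes K: "singular_knot_diagram K" and p: "p \<in> classical_crossings K"
  shows "2 * weight K p = crossing_sign K p * chord_index K (classical_crossings K) p"
proof -
  let ?l = "left_param K p" and ?r = "right_param K p" and ?C = "classical_crossings K"
  define f where "f = (SOME f. cheng_coloring K f)"
  have f: "cheng_coloring K f"
    unfolding f_def by (rule someI[of "cheng_coloring K"]) (rule cheng_coloring_standard[OF K])
  note lr = classical_crossing_at[OF K p]
  \<comment> \<open>Passing from floors to \<open>step\<close> leaves the term \<open>jump\<close>,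
    which is -1 at the left and 1 at the right parameter; the difference -2 cancels twice the
    \<open>+ 1\<close> of \<open>W_plus_eq\<close>.\<close>
  have two: "2 * standard_coloring K u =
      (\<Sum>d\<in>?C. step (u - right_param K d) - step (u - left_param K d)) + jump K u" for u
    unfolding standard_coloring_def jump_def sum_distrib_left sum.distrib[symmetric]
    by (rule sum.cong) (simp_all add: right_diff_distrib double_floor_eq_step)
  have "2 * W_plus K f p = chord_index K ?C p"
    using two[of ?l] two[of ?r] jump_eq[OF K p lr] W_plus_eq[OF K f p lr]
    by (simp add: chord_index_def chord_linking_def linking_def sum.distrib sum_subtractf)
  moreover have "weight K p = crossing_sign K p * W_plus K f p"
    unfolding weight_def Let_def f_def[symmetric]
    by (simp add: crossing_sign_def W_plus_def W_minus_def)
  ultimately show ?thesis by simp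
qed

text \<open>Here \<open>s\<close> is the sign and \<open>i\<close> the chord index of a crossing.
  The chord index is twice \<open>W_plus\<close>, so \<open>s * i / 2\<close> is the weight.\<close>

definition contribution :: "nat \<Rightarrow> int \<Rightarrow> int \<Rightarrow> real" where
  "contribution n s i = of_int s * (of_int (s * i) / 2) ^ n"

lemma v_inv_eq:
  assumes K: "singular_knot_diagram K"
  shows "v_inv n K = 1 / fact n * (\<Sum>p\<in>classical_crossings K.
     contribution n (crossing_sign K p) (chord_index K (classical_crossings K) p))"
proof -
  have w: "real_of_int (weight K p) =
      of_int (crossing_sign K p * chord_index K (classical_crossings K) p) / 2"
    if "p \<in> classical_crossings K" for p
    using arg_cong[OF double_weight[OF K that], of real_of_int] by simp
  show ?thesis
    unfolding v_inv_def contribution_def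
    by (intro arg_cong2[where f = "(*)"] refl sum.cong) (simp_all only: w)
qed

section \<open>Isotopy, reparametrization and detour\<close>

text \<open>Signs and chord indices see parameters only through \<open>over\<close> and through
  \<open>step\<close> of differences, so a parameter map \<open>\<tau>\<close> respecting both
  transfers the whole sum. One pair of parameters per crossing suffices, since linking numbers
  ignore integer shifts.\<close>

lemma v_inv_eqI:
  assumes K: "singular_knot_diagram K" and K': "singular_knot_diagram K'"
    and g: "bij_betw g (classical_crossings K) (classical_crossings K')"
    and step: "\<And>a b. step (\<tau> a - \<tau> b) = step (a - b)"
    and crossings: "\<And>p. p \<in> classical_crossings K \<Longrightarrow> \<exists>l r. crossing_at K p l r \<and>
      crossing_at K' (g p) (\<tau> l) (\<tau> r) \<and> (\<tau> l \<in> over K' \<longleftrightarrow> l \<in> over K)"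
  shows "v_inv n K = v_inv n K'"
proof -
  note G = singular_imp_generic[OF K] and G' = singular_imp_generic[OF K']
  have sign: "crossing_sign K' (g p) = crossing_sign K p" if p: "p \<in> classical_crossings K" for p
    using crossings[OF p] crossing_sign_eq[OF K] crossing_sign_eq[OF K'] by auto
  have link: "chord_linking K' (g p) (g d) = chord_linking K p d"
    if p: "p \<in> classical_crossings K" and d: "d \<in> classical_crossings K" for p d
  proof -
    obtain l r where lr: "crossing_at K p l r" "crossing_at K' (g p) (\<tau> l) (\<tau> r)"
      using crossings[OF p] by blast
    obtain l' r' where lr': "crossing_at K d l' r'" "crossing_at K' (g d) (\<tau> l') (\<tau> r')"
      using crossings[OF d] by blast
    show ?thesis
      by (simp add: chord_linking_eq[OF G lr(1) lr'(1)] chord_linking_eq[OF G' lr(2) lr'(2)]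
          linking_def step)
  qed
  have index: "chord_index K' (classical_crossings K') (g p) = chord_index K (classical_crossings K) p"
    if p: "p \<in> classical_crossings K" for p
    unfolding chord_index_def sum.reindex_bij_betw[OF g, symmetric]
    by (rule sum.cong[OF refl]) (rule link[OF p])
  show ?thesis
    unfolding v_inv_eq[OF K] v_inv_eq[OF K'] sum.reindex_bij_betw[OF g, symmetric]
    by (intro arg_cong2[where f = "(*)"] refl sum.cong) (simp add: sign index)
qed

lemma velocity_eq_open:
  assumes "generic_closed_curve K" "open S" "u \<in> S" "\<And>w. w \<in> S \<Longrightarrow> curve K' w = curve K w"
  shows "velocity K' u = velocity K u"
proof (rule vector_derivative_at)
  show "(curve K' has_vector_derivative velocity K u) (at u)"
    by (rule has_vector_derivative_transform_within_open[OF has_velocity[OF assms(1)] assms(2,3)])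
      (simp add: assms(4))
qed

section \<open>Determinants and orientation along a planar isotopy\<close>

lemma cross_linear:
  assumes "linear D"
  shows "cross (D a) (D b) = cross (D 1) (D \<i>) * cross a b"
proof -
  have D: "D z = Re z *\<^sub>R D 1 + Im z *\<^sub>R D \<i>" for z
  proof -
    have "z = Re z *\<^sub>R 1 + Im z *\<^sub>R \<i>" by (simp add: complex_eq_iff)
    then show ?thesis using linear_add[OF assms] linear_scale[OF assms] by metis
  qed
  show ?thesis unfolding D[of a] D[of b] by (simp add: cross_def algebra_simps)
qed

text \<open>The expression is the determinant of \<open>D\<close>. If it vanishes, its entries
  provide the kernel vectors \<open>x\<close> and then \<open>y\<close>; injectivity makes both
  zero, which forces \<open>D 1 = 0\<close>.\<close>

lemma cross_injective_linear:
  assumes "linear D" "inj D"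
  shows "cross (D 1) (D \<i>) \<noteq> 0"
proof
  assume 0: "cross (D 1) (D \<i>) = 0"
  have ker: "z = 0" if "D z = 0" for z
    using that assms linear_0[OF assms(1)] by (metis injD)
  define x where "x = Im (D \<i>) *\<^sub>R 1 - Im (D 1) *\<^sub>R \<i>"
  have Dx: "D x = Im (D \<i>) *\<^sub>R D 1 - Im (D 1) *\<^sub>R D \<i>"
    unfolding x_def by (simp only: linear_diff[OF assms(1)] linear_scale[OF assms(1)])
  then have "D x = 0" using 0 by (simp add: cross_def complex_eq_iff algebra_simps)
  then have "x = 0" by (rule ker)
  then have im: "Im (D \<i>) = 0" "Im (D 1) = 0" by (simp_all add: x_def complex_eq_iff)
  define y where "y = Re (D \<i>) *\<^sub>R 1 - Re (D 1) *\<^sub>R \<i>"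
  have Dy: "D y = Re (D \<i>) *\<^sub>R D 1 - Re (D 1) *\<^sub>R D \<i>"
    unfolding y_def by (simp only: linear_diff[OF assms(1)] linear_scale[OF assms(1)])
  then have "D y = 0" using im by (simp add: complex_eq_iff algebra_simps)
  then have "y = 0" by (rule ker)
  then have "Re (D 1) = 0" by (simp add: y_def complex_eq_iff)
  with im have "D 1 = 0" by (simp add: complex_eq_iff)
  from ker[OF this] show False by simp
qed

text \<open>The determinant of the derivative at a fixed point is continuous in time, never 0, and 1
  at time 0, so it is still positive at time 1.\<close>

lemma planar_isotopy_orientation:
  assumes "planar_isotopy H"
  shows "\<exists>D. \<forall>z. (H 1 has_derivative D z) (at z) \<and> cross (D z 1) (D z \<i>) > 0"
proof -
  obtain H' :: "real \<Rightarrow> complex \<Rightarrow> complex \<Rightarrow>\<^sub>L complex" where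
    cont: "continuous_on ({0..1} \<times> UNIV) (\<lambda>(t, z). H' t z)"
    and der: "\<forall>t\<in>{0..1}. \<forall>z. (H t has_derivative blinfun_apply (H' t z)) (at z) \<and>
                         inj (blinfun_apply (H' t z))"
    and H0: "H 0 = id"
    using assms unfolding planar_isotopy_def by (elim conjE exE)
  have "cross (H' 1 z 1) (H' 1 z \<i>) > 0" for z
  proof -
    define d where "d t = cross (H' t z 1) (H' t z \<i>)" for t
    have "continuous_on {0..1} ((\<lambda>(t, z). H' t z) \<circ> (\<lambda>t. (t, z)))"
      by (rule continuous_on_compose[OF _ continuous_on_subset[OF cont]])
        (auto intro!: continuous_intros)
    then have c: "continuous_on {0..1} (\<lambda>t. H' t z)" by (simp add: comp_def)
    have "continuous_on {0..1} d"
      unfolding d_def cross_def by (intro continuous_intros c)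
    moreover have "d t \<noteq> 0" if "t \<in> {0..1}" for t
      unfolding d_def using der that
      by (intro cross_injective_linear bounded_linear.linear[OF blinfun.bounded_linear_right]) blast
    moreover have "d 0 = 1"
    proof -
      have "(id has_derivative blinfun_apply (H' 0 z)) (at z)" using bspec[OF der, of 0] H0 by simp
      then have "blinfun_apply (H' 0 z) = id"
        using has_derivative_unique[OF has_derivative_id] by (metis id_def)
      then show ?thesis by (simp add: d_def cross_def)
    qed
    ultimately have "\<not> d 1 \<le> 0"
      using IVT2'[of d 1 0 0] by force
    then show ?thesis by (simp add: d_def)
  qed
  moreover have "\<forall>z. (H 1 has_derivative blinfun_apply (H' 1 z)) (at z)"
    using bspec[OF der, of 1] by simp
  ultimately show ?thesis by (intro exI[of _ "\<lambda>z. blinfun_apply (H' 1 z)"]) simp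
qed

lemma v_inv_isotopy:
  assumes K: "singular_knot_diagram K" and K': "singular_knot_diagram K'"
    and H: "planar_isotopy H" and eq: "K' = K\<lparr>curve := H 1 \<circ> curve K\<rparr>"
  shows "v_inv n K = v_inv n K'"
proof (rule v_inv_eqI[OF K K', where g = "H 1" and \<tau> = "\<lambda>u. u"])
  obtain D where D: "\<And>z. (H 1 has_derivative D z) (at z)" "\<And>z. cross (D z 1) (D z \<i>) > 0"
    using planar_isotopy_orientation[OF H] by blast
  have lin: "linear (D z)" for z using D(1) has_derivative_linear by blast
  have vel: "velocity K' u = D (curve K u) (velocity K u)" for u
  proof (rule vector_derivative_at)
    have "(curve K has_derivative (\<lambda>x. x *\<^sub>R velocity K u)) (at u)"
      using has_velocity[OF singular_imp_generic[OF K]] by (simp add: has_vector_derivative_def)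
    from diff_chain_at[OF this D(1)]
    show "(curve K' has_vector_derivative D (curve K u) (velocity K u)) (at u)"
      by (simp add: eq has_vector_derivative_def comp_def linear_scale[OF lin])
  qed
  have bij: "bij (H 1)" using H by (simp add: planar_isotopy_def)
  have "classical_crossings K' = H 1 ` classical_crossings K"
    by (simp add: classical_crossings_def eq image_comp)
  then show "bij_betw (H 1) (classical_crossings K) (classical_crossings K')"
    using bij by (simp add: bij_betw_def inj_on_subset[OF bij_is_inj])
  fix p assume "p \<in> classical_crossings K"
  note lr = classical_crossing_at[OF K this]
  have "cross (D p (velocity K (left_param K p))) (D p (velocity K (right_param K p))) > 0"
    by (subst cross_linear[OF lin]) (use D(2) lr in \<open>simp add: crossing_at_def\<close>)
  with lr show "\<exists>l r. crossing_at K p l r \<and> crossing_at K' (H 1 p) l r \<and> (l \<in> over K' \<longleftrightarrow> l \<in> over K)"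
    by (intro exI[of _ "left_param K p"] exI[of _ "right_param K p"])
      (simp add: crossing_at_def vel, simp add: eq)
qed simp

lemma v_inv_reparametrization:
  assumes K: "singular_knot_diagram K" and K': "singular_knot_diagram K'"
    and \<phi>: "circle_reparametrization \<phi>"
    and eq: "K' = K\<lparr>curve := curve K \<circ> \<phi>, over := \<phi> -` over K, under := \<phi> -` under K\<rparr>"
  shows "v_inv n K = v_inv n K'"
proof -
  have C1: "\<phi> C1_differentiable_on UNIV" and per: "\<And>u. \<phi> (u + 1) = \<phi> u + 1"
    and pos: "\<And>u. deriv \<phi> u > 0"
    using \<phi> by (auto simp: circle_reparametrization_def)
  have der: "(\<phi> has_real_derivative deriv \<phi> u) (at u)" for u
  proof -
    have "\<phi> differentiable (at u)" using C1 by (simp add: C1_differentiable_on_eq)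
    then show ?thesis using DERIV_deriv_iff_real_differentiable by blast
  qed
  have mono: "\<phi> a < \<phi> b" if "a < b" for a b
    using DERIV_pos_imp_increasing[OF that] der pos by blast
  have le_iff: "\<phi> a \<le> \<phi> b \<longleftrightarrow> a \<le> b" for a b
    using mono[of a b] mono[of b a] by (cases a b rule: linorder_cases) auto
  have int: "\<phi> (u + of_int k) = \<phi> u + of_int k" for u k
    using periodic_int[of "\<lambda>u. \<phi> u - u" u k] per by simp
  have surj: "surj \<phi>"
    unfolding surj_def
  proof
    fix y
    \<comment> \<open>Chosen so that \<open>y\<close> lies between the values of
      \<open>\<phi>\<close> at \<open>k\<close> and \<open>k + 1\<close>, which are
      \<open>\<phi> 0 + k\<close> and \<open>\<phi> 0 + k + 1\<close>.\<close>
    define k where "k = \<lfloor>y - \<phi> 0\<rfloor>"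
    have "\<phi> (of_int k) \<le> y" "y \<le> \<phi> (of_int k + 1)"
      using int[of 0 k] per[of "of_int k"] unfolding k_def by simp_all linarith+
    moreover have "continuous_on {of_int k..of_int k + 1} \<phi>"
      using der DERIV_isCont by (blast intro: continuous_at_imp_continuous_on)
    ultimately obtain x where "\<phi> x = y"
      using IVT'[of \<phi> "of_int k" y "of_int k + 1"] by auto
    then show "\<exists>x. y = \<phi> x" by blast
  qed
  \<comment> \<open>The new diagram passes at \<open>\<tau> u\<close> the point that the old one
    passes at \<open>u\<close>.\<close>
  define \<tau> where "\<tau> = inv \<phi>"
  have \<phi>\<tau>: "\<phi> (\<tau> a) = a" for a unfolding \<tau>_def by (rule surj_f_inv_f[OF surj])
  \<comment> \<open>Since \<open>\<phi>\<close> is increasing and commutes with integer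
    translations, \<open>\<tau> a - \<tau> b\<close> and \<open>a - b\<close> compare in the same
    way with every integer.\<close>
  have step: "step (\<tau> a - \<tau> b) = step (a - b)" for a b
  proof -
    have \<phi>\<tau>_int: "\<phi> (\<tau> b + of_int k) = b + of_int k" for k
      by (simp add: int \<phi>\<tau>)
    have 1: "of_int k \<le> \<tau> a - \<tau> b \<longleftrightarrow> of_int k \<le> a - b" for k
      using le_iff[of "\<tau> b + of_int k" "\<tau> a"] unfolding \<phi>\<tau> \<phi>\<tau>_int by linarith
    have 2: "\<tau> a - \<tau> b \<le> of_int k \<longleftrightarrow> a - b \<le> of_int k" for k
      using le_iff[of "\<tau> a" "\<tau> b + of_int k"] unfolding \<phi>\<tau> \<phi>\<tau>_int by linarith
    have "\<lfloor>\<tau> a - \<tau> b\<rfloor> = \<lfloor>a - b\<rfloor>"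
      using 1[of "\<lfloor>a - b\<rfloor>"] 1[of "\<lfloor>\<tau> a - \<tau> b\<rfloor>"] by (simp add: le_floor_iff antisym)
    moreover have "\<lceil>\<tau> a - \<tau> b\<rceil> = \<lceil>a - b\<rceil>"
      using 2[of "\<lceil>a - b\<rceil>"] 2[of "\<lceil>\<tau> a - \<tau> b\<rceil>"] by (simp add: ceiling_le_iff antisym)
    ultimately show ?thesis by (simp add: step_def)
  qed
  have vel: "velocity K' u = deriv \<phi> u *\<^sub>R velocity K (\<phi> u)" for u
  proof (rule vector_derivative_at)
    have "(\<phi> has_vector_derivative deriv \<phi> u) (at u)"
      using der has_real_derivative_iff_has_vector_derivative by blast
    from vector_diff_chain_at[OF this has_velocity[OF singular_imp_generic[OF K]]]
    show "(curve K' has_vector_derivative deriv \<phi> u *\<^sub>R velocity K (\<phi> u)) (at u)"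
      by (simp add: eq)
  qed
  have "classical_crossings K' = curve K ` \<phi> ` (\<phi> -` (over K \<union> under K))"
    by (simp add: classical_crossings_def eq image_comp vimage_Un)
  then have "classical_crossings K' = classical_crossings K"
    by (simp only: classical_crossings_def surj_image_vimage_eq[OF surj])
  then have bij: "bij_betw (\<lambda>p. p) (classical_crossings K) (classical_crossings K')"
    by (simp add: bij_betw_def)
  show ?thesis
  proof (rule v_inv_eqI[OF K K' bij, where \<tau> = \<tau>, OF step])
    fix p assume "p \<in> classical_crossings K"
    from classical_crossing_at[OF K this]
    show "\<exists>l r. crossing_at K p l r \<and> crossing_at K' p (\<tau> l) (\<tau> r) \<and> (\<tau> l \<in> over K' \<longleftrightarrow> l \<in> over K)"
      using pos by (intro exI[of _ "left_param K p"] exI[of _ "right_param K p"])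
        (simp add: crossing_at_def vel \<phi>\<tau>, simp add: eq \<phi>\<tau>)
  qed
qed

lemma v_inv_detour:
  assumes K: "singular_knot_diagram K" and K': "singular_knot_diagram K'"
    and move: "detour_move K K'"
  shows "v_inv n K = v_inv n K'"
proof -
  obtain a b where ab: "a < b" "b < a + 1" "\<forall>u\<in>{b..a + 1}. curve K' u = curve K u"
      "over K' = over K" "under K' = under K" "(over K \<union> under K) \<inter> {a..b} = {}"
    using move unfolding detour_move_def by (elim exE conjE)
  note G = singular_imp_generic[OF K] and G' = singular_imp_generic[OF K']
  have agree: "curve K' u = curve K u" "velocity K' u = velocity K u" if u: "u \<in> over K \<union> under K" for u
  proof -
    \<comment> \<open>The representative of \<open>u\<close> in the period from \<open>a\<close> to
      \<open>a + 1\<close>. Avoiding the closed arc puts it in the open interval from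
      \<open>b\<close> to \<open>a + 1\<close>, and openness yields equal velocities as well as
      equal points.\<close>
    define w where "w = u - of_int \<lfloor>u - a\<rfloor>"
    have wu: "w - u \<in> \<int>" by (simp add: w_def)
    have "w \<in> over K \<union> under K"
      using u over_Ints[OF K wu] under_Ints[OF K wu] by blast
    then have "w \<notin> {a..b}" using ab(6) by blast
    moreover have "a \<le> w" "w < a + 1" unfolding w_def by linarith+
    ultimately have w: "w \<in> {b<..<a + 1}" by auto
    have "velocity K' w = velocity K w"
      by (rule velocity_eq_open[OF G open_greaterThanLessThan w]) (use ab(3) in simp)
    then show "velocity K' u = velocity K u"
      using velocity_Ints[OF G wu] velocity_Ints[OF G' wu] by simp
    have "curve K' w = curve K w" using ab(3) w by simp
    then show "curve K' u = curve K u"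
      using curve_Ints[OF G wu] curve_Ints[OF G' wu] by simp
  qed
  have "classical_crossings K' = classical_crossings K"
    unfolding classical_crossings_def ab(4,5) by (rule image_cong[OF refl]) (rule agree)
  then have bij: "bij_betw (\<lambda>p. p) (classical_crossings K) (classical_crossings K')"
    by (simp add: bij_betw_def)
  show ?thesis
  proof (rule v_inv_eqI[OF K K' bij, where \<tau> = "\<lambda>u. u"])
    fix p assume p: "p \<in> classical_crossings K"
    note lr = classical_crossing_at[OF K p]
    have "left_param K p \<in> over K \<union> under K" "right_param K p \<in> over K \<union> under K"
      using lr p crossing_param_iff[OF K] by (simp_all add: crossing_at_def)
    note agree[OF this(1)] agree[OF this(2)]
    with lr show "\<exists>l r. crossing_at K p l r \<and> crossing_at K' p l r \<and> (l \<in> over K' \<longleftrightarrow> l \<in> over K)"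
      by (intro exI[of _ "left_param K p"] exI[of _ "right_param K p"])
        (simp add: crossing_at_def ab(4))
  qed simp
qed

section \<open>Moves inside the window\<close>

text \<open>A crossing of two prescribed strands, where \<open>\<epsilon>\<close> records which of them is incoming on the left;
  exchanging the two strands changes the sign of all linking numbers.\<close>

definition oriented_crossing :: "vdiagram \<Rightarrow> complex \<Rightarrow> int \<Rightarrow> real \<Rightarrow> real \<Rightarrow> bool" where
  "oriented_crossing K p \<epsilon> x y \<longleftrightarrow>
     \<epsilon> = 1 \<and> crossing_at K p x y \<or> \<epsilon> = -1 \<and> crossing_at K p y x"

lemma linking_flip:
  "linking b a c d = - linking a b c d" "linking a b d c = - linking a b c d"
  by (simp_all add: linking_def)

lemma chord_linking_oriented:
  assumes "generic_closed_curve K" "oriented_crossing K p \<epsilon> x y" "oriented_crossing K d \<delta> x' y'"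
  shows "chord_linking K p d = \<epsilon> * \<delta> * linking x y x' y'"
  using assms(2,3) unfolding oriented_crossing_def
  by (elim disjE conjE)
    (simp_all add: chord_linking_eq[OF assms(1)] linking_flip(1)[of y x] linking_flip(2)[of _ _ y' x'])

lemma oriented_crossing_params:
  "crossing_at K p l r \<Longrightarrow> oriented_crossing K p 1 l r"
  by (simp add: oriented_crossing_def)

text \<open>Stated for interior parameters because at the ends of a strand the two-sided derivative
  also sees the curve outside the picture.\<close>

lemma velocity_affine:
  assumes K: "generic_closed_curve K"
    and eq: "\<And>t. t \<in> {-1..1} \<Longrightarrow> curve K (c + r * t) = T t"
    and t: "t \<in> {-1<..<1}" and der: "(T has_vector_derivative a) (at t)"
  shows "a = r *\<^sub>R velocity K (c + r * t)"
proof -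
  have "((\<lambda>t. c + r * t) has_vector_derivative r) (at t)"
    by (auto intro!: derivative_eq_intros)
  from vector_diff_chain_at[OF this has_velocity[OF K]]
  have 1: "((\<lambda>t. curve K (c + r * t)) has_vector_derivative r *\<^sub>R velocity K (c + r * t)) (at t)"
    by (simp add: comp_def)
  have "(T has_vector_derivative r *\<^sub>R velocity K (c + r * t)) (at t)"
    by (rule has_vector_derivative_transform_within_open[OF 1 open_greaterThanLessThan t])
      (use eq in simp)
  from vector_derivative_at[OF this] vector_derivative_at[OF der] show ?thesis by simp
qed

section \<open>Strands and crossings of a single picture\<close>

locale picture =
  fixes K :: vdiagram and T :: "(real \<Rightarrow> complex) list" and c r :: "nat \<Rightarrow> real" and h :: "nat \<Rightarrow> nat"
  assumes singular: "singular_knot_diagram K"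
    and shown: "shows_picture K T c r"
    and layers: "layered K (length T) c r h"
    and inj_h: "inj_on h {..<length T}"
begin

definition param :: "nat \<Rightarrow> real \<Rightarrow> real" where
  "param i t = c i + r i * t"

definition inner :: "complex set" where
  "inner = classical_crossings K \<inter> window"

definition outer :: "complex set" where
  "outer = classical_crossings K - window"

definition direction :: "nat \<Rightarrow> int" where
  "direction i = (if r i > 0 then 1 else -1)"

lemmas generic = singular_imp_generic[OF singular]

lemma shownD:
  shows "\<forall>i<length T. r i \<noteq> 0 \<and> 2 * \<bar>r i\<bar> < 1"
    and "disjoint_family_on (strand c r) {..<length T}"
    and "\<forall>i<length T. \<forall>t\<in>{-1..1}. curve K (c i + r i * t) = (T ! i) t"
    and "curve K -` window = (\<Union>i<length T. strand c r i)"
  using shown unfolding shows_picture_def by - (elim conjE, assumption)+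

lemma layersD:
  shows "double_points K \<inter> window \<subseteq> classical_crossings K"
    and "\<forall>i<length T. \<forall>j<length T. \<forall>u \<in> strand c r i. \<forall>v \<in> strand c r j.
        curve K u = curve K v \<and> h i > h j \<longrightarrow> u \<in> over K \<and> v \<in> under K"
  using layers unfolding layered_def by - (elim conjE, assumption)+

lemma param_in_strand: "t \<in> {-1..1} \<Longrightarrow> param i t + of_int k \<in> strand c r i"
  by (auto simp: strand_def param_def)

lemma param_in_strand_0: "t \<in> {-1..1} \<Longrightarrow> param i t \<in> strand c r i"
  using param_in_strand[of t i 0] by simp

lemma curve_param: "i < length T \<Longrightarrow> t \<in> {-1..1} \<Longrightarrow> curve K (param i t) = (T ! i) t"
  using shownD(3) by (simp add: param_def)

lemma window_param:
  assumes "curve K u \<in> window"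
  obtains i t where "i < length T" "t \<in> {-1..1}" "u - param i t \<in> \<int>"
proof -
  obtain i where i: "i < length T" "u \<in> strand c r i"
    using assms shownD(4) by blast
  then obtain t k where "t \<in> {-1..1}" "u = param i t + of_int k"
    by (auto simp: strand_def param_def)
  then have "t \<in> {-1..1}" "u - param i t \<in> \<int>" by simp_all
  with i(1) show ?thesis by (rule that)
qed

text \<open>As the position moves along the strand, \<open>x - param i t\<close> reaches an integer
  only if \<open>x\<close> lies on a translate of the strand, which is excluded.\<close>

lemma step_param_const:
  assumes "i < length T" "x \<notin> strand c r i" "s \<in> {-1..1}" "t \<in> {-1..1}"
  shows "step (x - param i s) = step (x - param i t)"
proof (rule no_integer_between_step)
  fix k :: int
  show "of_int k \<notin> closed_segment (x - param i s) (x - param i t)"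
  proof
    assume "of_int k \<in> closed_segment (x - param i s) (x - param i t)"
    then obtain u where u: "0 \<le> u" "u \<le> 1"
      and k: "of_int k = (1 - u) * (x - param i s) + u * (x - param i t)"
      by (auto simp: closed_segment_def)
    define y where "y = (1 - u) * s + u * t"
    have "y \<in> closed_segment s t"
      using u by (auto simp: closed_segment_def y_def)
    then have "y \<in> {-1..1}"
      using closed_segment_subset[OF assms(3,4) convex_real_interval(5)] by (rule rev_subsetD)
    from param_in_strand[OF this] have "param i y + of_int k \<in> strand c r i" .
    moreover have "param i y + of_int k = x"
      unfolding k y_def param_def by (simp add: algebra_simps)
    ultimately show False using assms(2) by simp
  qed
qed

text \<open>Disjoint strands cannot pass each other on the circle. Each position is moved to the
  centre in turn, using that \<open>step\<close> is odd to exchange the two roles.\<close>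

lemma step_params_const:
  assumes "i < length T" "j < length T" "i \<noteq> j" "s \<in> {-1..1}" "t \<in> {-1..1}"
  shows "step (param i s - param j t) = step (c i - c j)"
proof -
  have "strand c r i \<inter> strand c r j = {}"
    using disjoint_family_onD[OF shownD(2), of i j] assms(1-3) by simp
  then have notin: "param i s \<notin> strand c r j" "param j 0 \<notin> strand c r i"
    using param_in_strand_0[OF assms(4), of i] param_in_strand_0[of 0 j] by auto
  have "step (param i s - param j t) = step (param i s - param j 0)"
    by (rule step_param_const[OF assms(2) notin(1) assms(5)]) simp
  also have "\<dots> = - step (param j 0 - param i s)" by (rule step_diff_commute)
  also have "step (param j 0 - param i s) = step (param j 0 - param i 0)"
    by (rule step_param_const[OF assms(1) notin(2) assms(4)]) simp
  also have "- \<dots> = step (param i 0 - param j 0)" by (rule step_diff_commute[symmetric])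
  finally show ?thesis by (simp add: param_def)
qed

text \<open>The bound \<open>2 * \<bar>r i\<bar> < 1\<close> keeps a strand shorter than the circle,
  so the difference stays strictly between -1 and 1, where \<open>step\<close> is the sign.\<close>

lemma step_param_self:
  assumes "i < length T" "s \<in> {-1..1}" "t \<in> {-1..1}"
  shows "step (param i s - param i t) = (if s < t then - direction i else if s = t then 0 else direction i)"
proof -
  have r: "r i \<noteq> 0" "2 * \<bar>r i\<bar> < 1" using shownD(1) assms(1) by auto
  have d: "param i s - param i t = r i * (s - t)" by (simp add: param_def algebra_simps)
  have "\<bar>s - t\<bar> \<le> 2" using assms(2,3) by auto
  then have "\<bar>r i * (s - t)\<bar> \<le> \<bar>r i\<bar> * 2"
    unfolding abs_mult by (rule mult_left_mono) simp
  then have bound: "-1 < r i * (s - t)" "r i * (s - t) < 1" using r(2) by linarith+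
  show ?thesis
  proof (cases "r i * (s - t) > 0")
    case True
    then show ?thesis
      unfolding d step_eq_1[OF True bound(2)]
      by (auto simp: direction_def zero_less_mult_iff)
  next
    case F: False
    show ?thesis
    proof (cases "r i * (s - t) < 0")
      case True
      then show ?thesis
        unfolding d step_eq_minus_1[OF bound(1) True]
        using r(1) by (auto simp: direction_def mult_less_0_iff)
    next
      case False
      then have "s = t" using F r(1) by (auto simp: not_less mult_eq_0_iff dest: antisym)
      then show ?thesis by simp
    qed
  qed
qed

lemma inner_obtain:
  assumes "p \<in> inner"
  obtains i j s t where "i < length T" "j < length T" "s \<in> {-1..1}" "t \<in> {-1..1}"
    "(T ! i) s = p" "(T ! j) t = p" "i \<noteq> j \<or> s \<noteq> t"
proof -
  have p: "p \<in> window" "p \<in> classical_crossings K" using assms by (auto simp: inner_def)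
  then have "p \<in> double_points K" using classical_crossings_subset[OF singular] by blast
  then obtain u v where uv: "curve K u = p" "curve K v = p" "u - v \<notin> \<int>"
    by (auto simp: double_points_def)
  obtain i s where i: "i < length T" "s \<in> {-1..1}" "u - param i s \<in> \<int>"
    using window_param[of u] uv(1) p(1) by blast
  obtain j t where j: "j < length T" "t \<in> {-1..1}" "v - param j t \<in> \<int>"
    using window_param[of v] uv(2) p(1) by blast
  have "(T ! i) s = p" "(T ! j) t = p"
    using curve_Ints[OF generic i(3)] curve_Ints[OF generic j(3)] uv(1,2)
      curve_param[OF i(1,2)] curve_param[OF j(1,2)] by simp_all
  moreover have "i \<noteq> j \<or> s \<noteq> t"
  proof (rule ccontr)
    assume "\<not> ?thesis"
    then have "u - v \<in> \<int>" using Ints_diff[OF i(3) j(3)] by simp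
    with uv(3) show False by blast
  qed
  ultimately show ?thesis using that[OF i(1) j(1) i(2) j(2)] by blast
qed

text \<open>The tangents of the picture are the velocities scaled by \<open>r i\<close> and
  \<open>r j\<close>, so traversing a strand backwards exchanges left and right incoming. The sign
  is therefore that of the picture times both directions.\<close>

lemma oriented_crossingI:
  assumes "i < length T" "j < length T" "s \<in> {-1<..<1}" "t \<in> {-1<..<1}"
    and "(T ! i) s = p" "(T ! j) t = p"
    and a: "((T ! i) has_vector_derivative a) (at s)" and b: "((T ! j) has_vector_derivative b) (at t)"
    and ne: "cross a b \<noteq> 0"
  shows "oriented_crossing K p (direction i * direction j * (if cross a b > 0 then 1 else -1))
    (param i s) (param j t)"
proof -
  have ri: "r i \<noteq> 0" "r j \<noteq> 0" using shownD(1) assms(1,2) by auto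
  have "a = r i *\<^sub>R velocity K (param i s)"
    unfolding param_def by (rule velocity_affine[OF generic _ assms(3) a]) (use shownD(3) assms(1) in simp)
  moreover have "b = r j *\<^sub>R velocity K (param j t)"
    unfolding param_def by (rule velocity_affine[OF generic _ assms(4) b]) (use shownD(3) assms(2) in simp)
  ultimately have ab: "cross a b = r i * r j * cross (velocity K (param i s)) (velocity K (param j t))"
    by simp
  have p: "curve K (param i s) = p" "curve K (param j t) = p"
    using curve_param assms(1-6) by auto
  show ?thesis
    unfolding oriented_crossing_def crossing_at_def p
      cross_commute[of "velocity K (param j t)" "velocity K (param i s)"]
    using ri ne unfolding ab direction_def
    by (auto simp: zero_less_mult_iff mult_less_0_iff not_less split: if_splits)
qed

lemma oriented_crossing_inner:
  assumes "oriented_crossing K p \<epsilon> x y" "p \<in> window"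
  shows "p \<in> inner"
proof -
  have "p \<in> double_points K"
    using assms(1) crossing_at_not_Ints[OF generic]
    unfolding oriented_crossing_def double_points_def crossing_at_def by blast
  then show ?thesis using layersD(1) assms(2) by (auto simp: inner_def)
qed

text \<open>Distinct strands have distinct heights, so the over strand is known;
  \<open>\<epsilon>\<close> tells whether it is the left incoming one.\<close>

lemma crossing_sign_oriented:
  assumes ij: "i < length T" "j < length T" "i \<noteq> j" "s \<in> {-1..1}" "t \<in> {-1..1}"
    and \<epsilon>: "oriented_crossing K p \<epsilon> (param i s) (param j t)"
  shows "crossing_sign K p = \<epsilon> * (if h i > h j then 1 else -1)"
proof -
  have eq: "curve K (param i s) = curve K (param j t)"
    using \<epsilon> by (auto simp: oriented_crossing_def crossing_at_def)
  note st = param_in_strand_0[OF ij(4), of i] param_in_strand_0[OF ij(5), of j]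
  have "h i \<noteq> h j" using inj_h ij(1-3) by (auto dest: inj_onD)
  have *: "(param i s \<in> over K \<longleftrightarrow> h i > h j) \<and> (param j t \<in> over K \<longleftrightarrow> \<not> h i > h j)"
  proof (cases "h i > h j")
    case True
    then have "param i s \<in> over K \<and> param j t \<in> under K"
      using layersD(2) ij(1,2) st eq by blast
    then show ?thesis using True singular_knot_diagramD(3)[OF singular] by blast
  next
    case False
    then have "h j > h i" using \<open>h i \<noteq> h j\<close> by simp
    then have "param j t \<in> over K \<and> param i s \<in> under K"
      using layersD(2) ij(1,2) st eq[symmetric] by blast
    then show ?thesis using False singular_knot_diagramD(3)[OF singular] by blast
  qed
  show ?thesis
    using \<epsilon> unfolding oriented_crossing_def
    by (elim disjE conjE) (simp_all add: crossing_sign_eq[OF singular] *)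
qed

lemma outer_crossing:
  assumes "d \<in> outer"
  shows "crossing_at K d (left_param K d) (right_param K d)"
    and "i < length T \<Longrightarrow> left_param K d \<notin> strand c r i"
    and "i < length T \<Longrightarrow> right_param K d \<notin> strand c r i"
proof -
  show lr: "crossing_at K d (left_param K d) (right_param K d)"
    using classical_crossing_at[OF singular] assms by (simp add: outer_def)
  have "curve K (left_param K d) \<notin> window" "curve K (right_param K d) \<notin> window"
    using lr assms by (auto simp: crossing_at_def outer_def)
  then show "i < length T \<Longrightarrow> left_param K d \<notin> strand c r i"
    "i < length T \<Longrightarrow> right_param K d \<notin> strand c r i"
    using shownD(4) by blast+
qed

text \<open>Linking of an outer chord with an ideal chord joining two whole strands, each contracted
  to its centre parameter.\<close>

definition strand_linking :: "complex \<Rightarrow> nat \<Rightarrow> nat \<Rightarrow> int" where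
  "strand_linking d i j = linking (left_param K d) (right_param K d) (c i) (c j)"

lemma strand_linking_self [simp]: "strand_linking d i i = 0"
  by (simp add: strand_linking_def linking_def)

text \<open>The endpoints of an outer chord avoid all strands, so the positions \<open>s\<close> and
  \<open>t\<close> of the inner crossing are irrelevant.\<close>

lemma chord_linking_outer:
  assumes d: "d \<in> outer" and ij: "i < length T" "j < length T" "s \<in> {-1..1}" "t \<in> {-1..1}"
    and \<epsilon>: "oriented_crossing K p \<epsilon> (param i s) (param j t)"
  shows "chord_linking K d p = \<epsilon> * strand_linking d i j"
proof -
  note lr = outer_crossing[OF d]
  have "step (left_param K d - param k u) = step (left_param K d - c k)"
    "step (right_param K d - param k u) = step (right_param K d - c k)"
    if "k < length T" "u \<in> {-1..1}" for k u
    using step_param_const[OF that(1) lr(2)[OF that(1)] that(2), of 0]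
      step_param_const[OF that(1) lr(3)[OF that(1)] that(2), of 0]
    by (simp_all add: param_def)
  then have "linking (left_param K d) (right_param K d) (param i s) (param j t) = strand_linking d i j"
    using ij by (simp add: strand_linking_def linking_def)
  then show ?thesis
    using chord_linking_oriented[OF generic oriented_crossing_params[OF lr(1)] \<epsilon>] by simp
qed

lemma chord_linking_outer':
  assumes "d \<in> outer" "i < length T" "j < length T" "s \<in> {-1..1}" "t \<in> {-1..1}"
    and "oriented_crossing K p \<epsilon> (param i s) (param j t)"
  shows "chord_linking K p d = - \<epsilon> * strand_linking d i j"
proof -
  have "chord_linking K p d = - chord_linking K d p"
    unfolding chord_linking_def by (rule linking_antisym)
  then show ?thesis using chord_linking_outer[OF assms] by simp
qed

lemma classical_crossings_split:
  "classical_crossings K = outer \<union> inner" "outer \<inter> inner = {}" "finite outer" "finite inner"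
  using finite_classical_crossings[OF singular] by (auto simp: outer_def inner_def)

lemma chord_index_split:
  "chord_index K (classical_crossings K) p =
     (\<Sum>d\<in>outer. chord_linking K p d) + (\<Sum>d\<in>inner. chord_linking K p d)"
  unfolding chord_index_def
  using classical_crossings_split by (simp add: sum.union_disjoint)

lemma v_inv_split:
  "v_inv n K = 1 / fact n *
    ((\<Sum>p\<in>outer. contribution n (crossing_sign K p) (chord_index K (classical_crossings K) p)) +
     (\<Sum>p\<in>inner. contribution n (crossing_sign K p) (chord_index K (classical_crossings K) p)))"
  unfolding v_inv_eq[OF singular]
  using classical_crossings_split by (simp add: sum.union_disjoint)

end

section \<open>Comparison of two diagrams that agree outside the window\<close>

locale window_move =
  A: picture K T c r h + B: picture K' T' c r h
  for K K' :: vdiagram and T T' c r h +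
  assumes same_length: "length T' = length T"
    and outside: "\<And>u. u \<notin> (\<Union>i<length T. strand c r i) \<Longrightarrow>
      curve K' u = curve K u \<and> (u \<in> over K' \<longleftrightarrow> u \<in> over K) \<and> (u \<in> under K' \<longleftrightarrow> u \<in> under K)"
begin

lemma outside_iff:
  "curve K u \<notin> window \<longleftrightarrow> u \<notin> (\<Union>i<length T. strand c r i)"
  "curve K' u \<notin> window \<longleftrightarrow> u \<notin> (\<Union>i<length T. strand c r i)"
  using A.shownD(4) B.shownD(4) same_length by auto

text \<open>The window is closed, so the curves agree on a whole neighbourhood of such a
  parameter.\<close>

lemma velocity_outside:
  assumes "curve K u \<notin> window"
  shows "velocity K' u = velocity K u"
proof (rule velocity_eq_open[OF A.generic, of "- (curve K -` window)"])
  have "closed ({z. \<bar>Re z\<bar> \<le> 1} \<inter> {z. \<bar>Im z\<bar> \<le> 1})"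
    by (intro closed_Int closed_Collect_le continuous_intros)
  also have "{z. \<bar>Re z\<bar> \<le> 1} \<inter> {z. \<bar>Im z\<bar> \<le> 1} = window" by (auto simp: window_def)
  finally have "closed window" .
  moreover have "continuous_on UNIV (curve K)"
    using isCont_curve[OF A.generic] by (simp add: continuous_on_eq_continuous_at)
  ultimately have "closed (curve K -` window)" by (rule closed_vimage)
  then show "open (- (curve K -` window))" by (simp add: open_Compl)
qed (use assms outside outside_iff in auto)

lemma crossing_at_outside:
  assumes "p \<notin> window"
  shows "crossing_at K' p x y \<longleftrightarrow> crossing_at K p x y"
proof -
  have same: "curve K' u = p \<longleftrightarrow> curve K u = p" for u
    using assms outside outside_iff by metis
  have "velocity K' u = velocity K u" if "curve K u = p" for u
    using velocity_outside that assms by simp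
  then show ?thesis unfolding crossing_at_def same by auto
qed

lemma outer_eq: "B.outer = A.outer"
proof -
  have "p \<in> classical_crossings K' \<longleftrightarrow> p \<in> classical_crossings K" if "p \<notin> window" for p
  proof -
    have "curve K' u = p \<and> u \<in> over K' \<union> under K' \<longleftrightarrow> curve K u = p \<and> u \<in> over K \<union> under K" for u
      using that outside[of u] outside_iff[of u] by auto
    then show ?thesis unfolding classical_crossings_def image_iff by metis
  qed
  then show ?thesis by (auto simp: A.outer_def B.outer_def)
qed

lemma params_outside:
  assumes "p \<notin> window"
  shows "left_param K' p = left_param K p" "right_param K' p = right_param K p"
proof -
  have "crossing_at K' p = crossing_at K p"
    by (intro ext) (rule crossing_at_outside[OF assms])
  then show "left_param K' p = left_param K p" "right_param K' p = right_param K p"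
    by (simp_all add: left_param_def right_param_def left_incoming_eq right_incoming_eq)
qed

lemma chord_linking_outside:
  assumes "p \<in> A.outer" "d \<in> A.outer"
  shows "chord_linking K' p d = chord_linking K p d"
  using assms params_outside by (simp add: chord_linking_def A.outer_def)

lemma strand_linking_outside:
  assumes "d \<in> A.outer"
  shows "B.strand_linking d i j = A.strand_linking d i j"
  using assms params_outside by (simp add: A.strand_linking_def B.strand_linking_def A.outer_def)

lemma crossing_sign_outside:
  assumes "p \<in> A.outer"
  shows "crossing_sign K' p = crossing_sign K p"
proof -
  have p: "p \<notin> window" using assms by (simp add: A.outer_def)
  have "u \<in> left_incoming K' p \<longleftrightarrow> u \<in> left_incoming K p" for u
    by (simp add: left_incoming_eq crossing_at_outside[OF p])
  moreover have "u \<in> over K' \<longleftrightarrow> u \<in> over K" if "u \<in> left_incoming K p" for u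
    using that p outside[of u] outside_iff(1)[of u] by (auto simp: left_incoming_def)
  ultimately show ?thesis unfolding crossing_sign_def by auto
qed

text \<open>Outer crossings keep their signs and their linking with each other. What remains to
  check is the total linking of each outer crossing with the inner ones, and the contributions of
  the inner ones.\<close>

lemma v_inv_window_eqI:
  assumes "\<And>p. p \<in> A.outer \<Longrightarrow>
      (\<Sum>d\<in>B.inner. chord_linking K' p d) = (\<Sum>d\<in>A.inner. chord_linking K p d)"
    and "(\<Sum>p\<in>B.inner. contribution n (crossing_sign K' p) (chord_index K' (classical_crossings K') p)) =
      (\<Sum>p\<in>A.inner. contribution n (crossing_sign K p) (chord_index K (classical_crossings K) p))"
  shows "v_inv n K = v_inv n K'"
proof -
  have "chord_index K' (classical_crossings K') p = chord_index K (classical_crossings K) p"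
    if "p \<in> A.outer" for p
    unfolding A.chord_index_split B.chord_index_split outer_eq
    using assms(1)[OF that] chord_linking_outside[OF that] by simp
  then have "(\<Sum>p\<in>A.outer. contribution n (crossing_sign K' p) (chord_index K' (classical_crossings K') p)) =
    (\<Sum>p\<in>A.outer. contribution n (crossing_sign K p) (chord_index K (classical_crossings K) p))"
    by (intro sum.cong refl) (simp add: crossing_sign_outside)
  with assms(2) show ?thesis
    unfolding A.v_inv_split B.v_inv_split outer_eq by simp
qed

end

lemma window_moveI:
  assumes "singular_knot_diagram K" "singular_knot_diagram K'" "picture_move T T' K K'"
  obtains c r h where "window_move K K' T T' c r h"
proof -
  from assms(3) obtain c r h where *: "length T = length T'" "inj_on h {..<length T}"
    "shows_picture K T c r" "layered K (length T) c r h"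
    "shows_picture K' T' c r" "layered K' (length T) c r h"
    "\<forall>u. u \<notin> (\<Union>i<length T. strand c r i) \<longrightarrow>
           curve K' u = curve K u \<and> (u \<in> over K' \<longleftrightarrow> u \<in> over K) \<and>
           (u \<in> under K' \<longleftrightarrow> u \<in> under K)"
    unfolding picture_move_def by (elim conjE exE)
  have "window_move K K' T T' c r h"
    by unfold_locales (use * assms(1,2) in simp_all)
  then show ?thesis by (rule that)
qed

section \<open>Reidemeister moves\<close>

lemma bump_minus: "bump (- t) = bump t"
  by (simp add: bump_def)

lemma bump_half: "bump (1 / 2) = 1" "bump (- 1 / 2) = 1" "bump (- (1 / 2)) = 1"
  by (simp_all add: bump_def power2_eq_square)

lemma square_le_1: "t \<in> {-1..1} \<Longrightarrow> t\<^sup>2 \<le> (1::real)"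
  by (simp add: abs_square_le_1 abs_le_iff)

lemma bump_eq_imp_square_eq:
  assumes "s \<in> {-1..1}" "t \<in> {-1..1}" "bump s = bump t"
  shows "s\<^sup>2 = t\<^sup>2"
proof -
  have "(1 - s\<^sup>2)\<^sup>2 = (1 - t\<^sup>2)\<^sup>2" using assms(3) by (simp add: bump_def)
  then have "1 - s\<^sup>2 = 1 - t\<^sup>2"
    by (rule power2_eq_imp_eq) (use square_le_1 assms(1,2) in simp_all)
  then show ?thesis by simp
qed

lemma bump_eq_1_imp:
  assumes "t \<in> {-1..1}" "bump t = 1"
  shows "t = 1 / 2 \<or> t = - 1 / 2"
proof -
  have "t\<^sup>2 = (1 / 2)\<^sup>2"
    by (rule bump_eq_imp_square_eq) (use assms bump_half in simp_all)
  then show ?thesis unfolding power2_eq_iff by simp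
qed

text \<open>The equation is a quartic with root 1/2. The remaining cubic factor has no root in the
  interval from 0 to 1, where \<open>t ^ 3\<close> and \<open>t\<^sup>2\<close> are at most
  \<open>t\<close>.\<close>

lemma bump_eq_double_imp:
  assumes "t \<in> {-1..1}" "bump t = 2 * t"
  shows "t = 1 / 2"
proof -
  have "0 \<le> bump t" by (simp add: bump_def)
  then have t: "0 \<le> t" "t \<le> 1" using assms by auto
  have "t ^ 3 \<le> t" "t\<^sup>2 \<le> t"
    using t power_decreasing[of 1 3 t] power_decreasing[of 1 2 t] by simp_all
  then have neg: "4 * t ^ 3 + 2 * t\<^sup>2 - 7 * t - 8 < 0" using t by linarith
  have "(2 * t - 1) * (4 * t ^ 3 + 2 * t\<^sup>2 - 7 * t - 8) = 0"
    using assms(2) unfolding bump_def by (simp add: power2_eq_square power3_eq_cube algebra_simps)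
  then show ?thesis using neg by simp
qed

lemma bump_has_derivative:
  "(bump has_real_derivative - 64 / 9 * t * (1 - t\<^sup>2)) (at t)"
  unfolding bump_def by (auto intro!: derivative_eq_intros simp: field_simps power2_eq_square)

lemma has_vector_derivative_ComplexI:
  assumes "(f has_real_derivative a) (at t)" "(g has_real_derivative b) (at t)"
  shows "((\<lambda>t. Complex (f t) (g t)) has_vector_derivative Complex a b) (at t)"
  using assms by (simp add: has_vector_derivative_complex_iff)

lemma Complex_in_window: "Complex x y \<in> window \<longleftrightarrow> \<bar>x\<bar> \<le> 1 \<and> \<bar>y\<bar> \<le> 1"
  by (simp add: window_def)

text \<open>For exponent 0 the sum over crossings would be the writhe, which a kink changes.\<close>

lemma contribution_0: "n \<ge> 1 \<Longrightarrow> contribution n s 0 = 0"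
  by (simp add: contribution_def)

text \<open>The weight \<open>s * i / 2\<close> is unchanged and only the outer sign flips; this is
  the cancellation of the two crossings of a bigon.\<close>

lemma contribution_minus: "contribution n (- s) (- i) = - contribution n s i"
  by (simp add: contribution_def)

lemma v_inv_R1:
  assumes K: "singular_knot_diagram K" "singular_knot_diagram K'"
    and move: "picture_move R1_before R1_after K K'" and n: "n \<ge> 1"
  shows "v_inv n K = v_inv n K'"
proof -
  obtain c r h where "window_move K K' R1_before R1_after c r h"
    using window_moveI[OF K move] .
  then interpret window_move K K' R1_before R1_after c r h .
  have before: "A.inner = {}"
  proof (rule equals0I)
    fix p assume "p \<in> A.inner"
    then show False by (rule A.inner_obtain) (auto simp: R1_before_def)
  qed
  let ?p = "Complex 0 (1 / 2)" and ?T = "\<lambda>t. Complex (t * (1 - bump t)) (bump t / 2)"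
  have T: "R1_after ! 0 = ?T" "length R1_after = 1" by (simp_all add: R1_after_def)
  have der: "(?T has_vector_derivative Complex (1 - bump t + 64 / 9 * t\<^sup>2 * (1 - t\<^sup>2)) (- 32 / 9 * t * (1 - t\<^sup>2))) (at t)" for t
    by (rule has_vector_derivative_ComplexI)
      (auto intro!: derivative_eq_intros bump_has_derivative simp: field_simps power2_eq_square)
  \<comment> \<open>The tangents of the picture are (4/3, 4/3) and (4/3, -4/3), with negative
    \<open>cross\<close>; the direction of the single strand enters squared.\<close>
  have crossing: "oriented_crossing K' ?p (- 1) (A.param 0 (- 1 / 2)) (A.param 0 (1 / 2))"
    using B.oriented_crossingI[of 0 0 "- 1 / 2" "1 / 2" ?p, unfolded T, OF _ _ _ _ _ _ der der]
    by (simp add: bump_half cross_def power2_eq_square A.direction_def split: if_splits)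
  have "B.inner = {?p}"
  proof (intro equalityI subsetI)
    fix p assume "p \<in> B.inner"
    then obtain i j s t where *: "i < length R1_after" "j < length R1_after" "s \<in> {-1..1}" "t \<in> {-1..1}"
      "(R1_after ! i) s = p" "(R1_after ! j) t = p" "i \<noteq> j \<or> s \<noteq> t"
      by (rule B.inner_obtain)
    then have st: "s \<noteq> t" and eq: "?T s = p" "?T t = p" by (simp_all add: R1_after_def)
    then have b: "bump s = bump t" by (auto simp: complex_eq_iff)
    then have "s\<^sup>2 = t\<^sup>2" using bump_eq_imp_square_eq * by blast
    \<comment> \<open>The real part of the kink is odd in \<open>t\<close>, so equal real parts at
      opposite parameters must both vanish.\<close>
    then have "s = - t" using st by (simp add: power2_eq_iff)
    then have "t * (1 - bump t) = 0" using eq b by (auto simp: complex_eq_iff)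
    moreover have "t \<noteq> 0" using st \<open>s = - t\<close> by simp
    ultimately have "bump t = 1" by simp
    then show "p \<in> {?p}" using eq by simp
  next
    fix p assume "p \<in> {?p}"
    then show "p \<in> B.inner"
      using B.oriented_crossing_inner[OF crossing] by (simp add: Complex_in_window)
  qed
  note after = this
  \<comment> \<open>Both ends of the chord of the kink lie on strand 0, and
    \<open>strand_linking d 0 0\<close> is 0.\<close>
  have link: "chord_linking K' d ?p = 0" "chord_linking K' ?p d = 0" if "d \<in> A.outer" for d
    using B.chord_linking_outer[OF _ _ _ _ _ crossing, of d]
      B.chord_linking_outer'[OF _ _ _ _ _ crossing, of d] that outer_eq
    by (simp_all add: T)
  have self: "chord_linking K' ?p ?p = 0" by (simp add: chord_linking_def)
  show ?thesis
    by (rule v_inv_window_eqI)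
      (simp_all add: before after link self B.chord_index_split outer_eq contribution_0[OF n])
qed

lemma v_inv_R2:
  assumes K: "singular_knot_diagram K" "singular_knot_diagram K'"
    and move: "picture_move R2_before R2_after K K'"
  shows "v_inv n K = v_inv n K'"
proof -
  obtain c r h where "window_move K K' R2_before R2_after c r h"
    using window_moveI[OF K move] .
  then interpret window_move K K' R2_before R2_after c r h .
  have before: "A.inner = {}"
  proof (rule equals0I)
    fix p assume "p \<in> A.inner"
    then show False by (rule A.inner_obtain) (auto simp: R2_before_def less_Suc_eq)
  qed
  let ?p = "Complex (- 1 / 2) 0" and ?q = "Complex (1 / 2) 0"
  let ?T = "\<lambda>t. Complex t 0" and ?T' = "\<lambda>t. Complex t ((1 - bump t) / 2)"
  have T: "R2_after ! 0 = ?T" "R2_after ! 1 = ?T'" "length R2_after = 2"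
    by (simp_all add: R2_after_def)
  have der: "(?T has_vector_derivative Complex 1 0) (at t)"
    and der': "(?T' has_vector_derivative Complex 1 (32 / 9 * t * (1 - t\<^sup>2))) (at t)" for t
    by (rule has_vector_derivative_ComplexI,
        auto intro!: derivative_eq_intros bump_has_derivative simp: field_simps power2_eq_square)+
  define \<epsilon> where "\<epsilon> = A.direction 0 * A.direction 1"
  \<comment> \<open>The pushed strand goes down at the first crossing and up at the second, hence
    the opposite orientations of \<open>?p\<close> and \<open>?q\<close>.\<close>
  have p: "oriented_crossing K' ?p (- \<epsilon>) (A.param 0 (- 1 / 2)) (A.param 1 (- 1 / 2))"
    using B.oriented_crossingI[of 0 1 "- 1 / 2" "- 1 / 2" ?p, unfolded T, OF _ _ _ _ _ _ der der']
    by (simp add: bump_half cross_def power2_eq_square \<epsilon>_def)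
  have q: "oriented_crossing K' ?q \<epsilon> (A.param 0 (1 / 2)) (A.param 1 (1 / 2))"
    using B.oriented_crossingI[of 0 1 "1 / 2" "1 / 2" ?q, unfolded T, OF _ _ _ _ _ _ der der']
    by (simp add: bump_half cross_def power2_eq_square \<epsilon>_def)
  have after: "B.inner = {?p, ?q}"
  proof (intro equalityI subsetI)
    fix x assume "x \<in> B.inner"
    then obtain i j s t where *: "i < length R2_after" "j < length R2_after" "s \<in> {-1..1}" "t \<in> {-1..1}"
      "(R2_after ! i) s = x" "(R2_after ! j) t = x" "i \<noteq> j \<or> s \<noteq> t"
      by (rule B.inner_obtain)
    have ij: "i = 0 \<or> i = 1" "j = 0 \<or> j = 1" using *(1,2) by (auto simp: T)
    then have "Re x = s" "Re x = t" using *(5,6) T by auto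
    then have st: "s = t" by simp
    then have "i \<noteq> j" using *(7) by simp
    then have x: "x = Complex t 0" "x = Complex t ((1 - bump t) / 2)"
      using ij *(5,6) T st by auto
    then have "bump t = 1" by simp
    then show "x \<in> {?p, ?q}" using bump_eq_1_imp[OF *(4)] x(1) by auto
  next
    fix x assume "x \<in> {?p, ?q}"
    then show "x \<in> B.inner"
      using B.oriented_crossing_inner[OF p] B.oriented_crossing_inner[OF q]
      by (auto simp: Complex_in_window)
  qed
  have pq: "?p \<noteq> ?q" by simp
  have outer: "chord_linking K' d ?p + chord_linking K' d ?q = 0"
    "chord_linking K' ?p d = - chord_linking K' ?q d" if "d \<in> A.outer" for d
    using B.chord_linking_outer[OF _ _ _ _ _ p, of d] B.chord_linking_outer[OF _ _ _ _ _ q, of d]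
      B.chord_linking_outer'[OF _ _ _ _ _ p, of d] B.chord_linking_outer'[OF _ _ _ _ _ q, of d]
      that outer_eq
    by (simp_all add: T)
  have "chord_linking K' ?p ?q = - chord_linking K' ?q ?p"
    unfolding chord_linking_def by (rule linking_antisym)
  moreover have "chord_linking K' ?p ?p = 0" "chord_linking K' ?q ?q = 0"
    by (simp_all add: chord_linking_def)
  moreover have "(\<Sum>d\<in>A.outer. chord_linking K' ?p d) = - (\<Sum>d\<in>A.outer. chord_linking K' ?q d)"
    unfolding sum_negf[symmetric] by (rule sum.cong[OF refl outer(2)])
  ultimately have index: "chord_index K' (classical_crossings K') ?p = - chord_index K' (classical_crossings K') ?q"
    unfolding B.chord_index_split after outer_eq
    by simp
  \<comment> \<open>The same strand is on top at both crossings while their orientations are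
    opposite.\<close>
  have "crossing_sign K' ?p = - crossing_sign K' ?q"
    using B.crossing_sign_oriented[OF _ _ _ _ _ p] B.crossing_sign_oriented[OF _ _ _ _ _ q]
    by (simp add: T)
  then have cancel: "contribution n (crossing_sign K' ?p) (chord_index K' (classical_crossings K') ?p) +
      contribution n (crossing_sign K' ?q) (chord_index K' (classical_crossings K') ?q) = 0"
    by (simp only: index contribution_minus left_minus)
  have sum_inner: "sum f B.inner = f ?p + f ?q" for f :: "complex \<Rightarrow> 'a::comm_monoid_add"
    by (simp add: after)
  show ?thesis
    by (rule v_inv_window_eqI) (simp_all only: before sum_inner outer(1) cancel sum.empty)
qed

section \<open>The triangle of the third move\<close>

definition R3_picture :: "real \<Rightarrow> (real \<Rightarrow> complex) list" where
  "R3_picture e = [\<lambda>t. Complex t (t / 2), \<lambda>t. Complex t (- t / 2), \<lambda>t. Complex t (e * bump t / 4)]"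

lemma R3_picture_eq: "R3_before = R3_picture 1" "R3_after = R3_picture (- 1)"
  by (simp_all add: R3_before_def R3_after_def R3_picture_def)

text \<open>The sign \<open>e\<close> covers the pictures before and after the move, so crossings
  and linking numbers are computed only once. The crossings \<open>p01\<close>, \<open>p02\<close>,
  \<open>p12\<close> are named after the strands meeting there.\<close>

locale R3_diagram = picture +
  fixes e :: real
  assumes R3: "T = R3_picture e" and e: "e = 1 \<or> e = - 1"
begin

definition "p01 = Complex 0 0"
definition "p02 = Complex (e / 2) (e / 4)"
definition "p12 = Complex (- e / 2) (e / 4)"

lemma T_simps:
  "T ! 0 = (\<lambda>t. Complex t (t / 2))" "T ! 1 = (\<lambda>t. Complex t (- t / 2))"
  "T ! 2 = (\<lambda>t. Complex t (e * bump t / 4))" "length T = 3"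
  by (simp_all add: R3 R3_picture_def)

lemma e_bounds: "0 \<in> {-1<..<1::real}" "e / 2 \<in> {-1<..<1}" "- e / 2 \<in> {-1<..<1}"
  "0 \<in> {-1..1::real}" "e / 2 \<in> {-1..1}" "- e / 2 \<in> {-1..1}"
  using e by auto

lemma T_derivatives:
  "((\<lambda>t. Complex t (t / 2)) has_vector_derivative Complex 1 (1 / 2)) (at t)"
  "((\<lambda>t. Complex t (- t / 2)) has_vector_derivative Complex 1 (- 1 / 2)) (at t)"
  "((\<lambda>t. Complex t (e * bump t / 4)) has_vector_derivative Complex 1 (- 16 / 9 * e * t * (1 - t\<^sup>2))) (at t)"
  by (rule has_vector_derivative_ComplexI,
      auto intro!: derivative_eq_intros bump_has_derivative simp: field_simps power2_eq_square)+

lemma crossings: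
  "oriented_crossing K p01 (- direction 0 * direction 1) (param 0 0) (param 1 0)"
  "oriented_crossing K p02 (- direction 0 * direction 2) (param 0 (e / 2)) (param 2 (e / 2))"
  "oriented_crossing K p12 (direction 1 * direction 2) (param 1 (- e / 2)) (param 2 (- e / 2))"
proof -
  have bump_e: "bump (e / 2) = 1" "bump (- e / 2) = 1" "bump (- (e / 2)) = 1"
    using e bump_half by auto
  have cross02: "cross (Complex 1 (1 / 2)) (Complex 1 (- 16 / 9 * e * (e / 2) * (1 - (e / 2)\<^sup>2))) < 0"
    and cross12: "cross (Complex 1 (- 1 / 2)) (Complex 1 (- 16 / 9 * e * (- e / 2) * (1 - (- e / 2)\<^sup>2))) > 0"
    using e by (auto simp: cross_def power2_eq_square)
  show "oriented_crossing K p01 (- direction 0 * direction 1) (param 0 0) (param 1 0)"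
    using oriented_crossingI[of 0 1 0 0 p01, unfolded T_simps, OF _ _ _ _ _ _ T_derivatives(1,2)]
    by (simp add: p01_def cross_def)
  show "oriented_crossing K p02 (- direction 0 * direction 2) (param 0 (e / 2)) (param 2 (e / 2))"
    using oriented_crossingI[of 0 2 "e / 2" "e / 2" p02, unfolded T_simps, OF _ _ _ _ _ _ T_derivatives(1,3)]
      e_bounds(2) cross02 by (simp add: p02_def bump_e)
  show "oriented_crossing K p12 (direction 1 * direction 2) (param 1 (- e / 2)) (param 2 (- e / 2))"
    using oriented_crossingI[of 1 2 "- e / 2" "- e / 2" p12, unfolded T_simps, OF _ _ _ _ _ _ T_derivatives(2,3)]
      e_bounds(3) cross12 by (simp add: p12_def bump_e)
qed

lemma distinct_crossings: "p01 \<noteq> p02" "p01 \<noteq> p12" "p02 \<noteq> p12"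
  using e by (auto simp: p01_def p02_def p12_def)

lemma inner_eq: "inner = {p01, p02, p12}"
proof (intro equalityI subsetI)
  fix p assume "p \<in> inner"
  then obtain i j s t where *: "i < length T" "j < length T" "s \<in> {-1..1}" "t \<in> {-1..1}"
    "(T ! i) s = p" "(T ! j) t = p" "i \<noteq> j \<or> s \<noteq> t"
    by (rule inner_obtain)
  have ij: "i = 0 \<or> i = 1 \<or> i = 2" "j = 0 \<or> j = 1 \<or> j = 2" using *(1,2) by (auto simp: T_simps(4))
  then have "Re p = s" "Re p = t" using *(5,6) T_simps(1-3) by auto
  then have st: "s = t" by simp
  then have "i \<noteq> j" using *(7) by simp
  have "p = Complex t (t / 2) \<and> p = Complex t (- t / 2) \<or>
      p = Complex t (t / 2) \<and> p = Complex t (e * bump t / 4) \<or>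
      p = Complex t (- t / 2) \<and> p = Complex t (e * bump t / 4)"
    using ij \<open>i \<noteq> j\<close> *(5,6) unfolding st by (elim disjE) (simp_all only: T_simps(1-3) simp_thms)
  then have "p = Complex t (t / 2) \<and> t = 0 \<or> p = Complex t (t / 2) \<and> bump t = 2 * (e * t) \<or>
      p = Complex t (- t / 2) \<and> bump t = 2 * (- e * t)"
    using e by (elim disjE conjE) simp_all
  then consider "p = Complex t (t / 2)" "t = 0" | "p = Complex t (t / 2)" "bump t = 2 * (e * t)"
    | "p = Complex t (- t / 2)" "bump t = 2 * (- e * t)"
    by blast
  then show "p \<in> {p01, p02, p12}"
  proof cases
    case 1
    then show ?thesis by (simp add: p01_def)
  next
    case 2
    \<comment> \<open>As \<open>bump\<close> is even, both signs of \<open>e\<close> reduce to the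
      same equation, now for \<open>e * t\<close>.\<close>
    have "bump (e * t) = 2 * (e * t)" using 2(2) e bump_minus[of t] by auto
    then have "e * t = 1 / 2" by (intro bump_eq_double_imp) (use *(4) e in auto)
    then have "t = e / 2" using e by auto
    then show ?thesis using 2(1) by (simp add: p02_def)
  next
    case 3
    have "bump (- e * t) = 2 * (- e * t)" using 3(2) e bump_minus[of t] by auto
    then have "- e * t = 1 / 2" by (intro bump_eq_double_imp) (use *(4) e in auto)
    then have "t = - e / 2" using e by auto
    then show ?thesis using 3(1) by (simp add: p12_def)
  qed
next
  have "p01 \<in> window" "p02 \<in> window" "p12 \<in> window"
    using e by (auto simp: p01_def p02_def p12_def Complex_in_window)
  note in_inner = oriented_crossing_inner[OF crossings(1) this(1)]
    oriented_crossing_inner[OF crossings(2) this(2)] oriented_crossing_inner[OF crossings(3) this(3)]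
  fix p assume "p \<in> {p01, p02, p12}"
  then show "p \<in> inner" using in_inner by auto
qed

lemma sum_inner: "sum f inner = f p01 + f p02 + f p12" for f :: "complex \<Rightarrow> 'c::comm_monoid_add"
  using distinct_crossings by (simp add: inner_eq add.assoc)

definition strand_step :: "nat \<Rightarrow> nat \<Rightarrow> int" where
  "strand_step i j = step (c i - c j)"

lemma steps:
  "\<lbrakk>i < 3; j < 3; i \<noteq> j; s \<in> {-1..1}; t \<in> {-1..1}\<rbrakk> \<Longrightarrow>
    step (param i s - param j t) = strand_step i j"
  "\<lbrakk>i < 3; s \<in> {-1..1}; t \<in> {-1..1}\<rbrakk> \<Longrightarrow>
    step (param i s - param i t) = (if s < t then - direction i else if s = t then 0 else direction i)"
  using step_params_const[of i j s t] step_param_self[of i s t]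
  by (simp_all add: T_simps(4) strand_step_def)

lemma direction_cases: "direction i = 1 \<or> direction i = - 1"
  by (simp add: direction_def)

text \<open>Two crossings of the triangle share exactly one strand, so a single term depends on
  their order on it. Multiplied out, this term is
  \<open>direction 0 * direction 1 * direction 2\<close> times the sign of \<open>e\<close> in all
  three cases, with the signs +, -, +.\<close>

lemma triangle_linking:
  "chord_linking K p01 p02 = direction 1 * direction 2 *
     (strand_step 0 2 + strand_step 1 0 - strand_step 1 2 + (if e = 1 then 1 else -1) * direction 0)"
  "chord_linking K p01 p12 = - direction 0 * direction 2 *
     (strand_step 0 2 - strand_step 0 1 - strand_step 1 2 + (if e = 1 then 1 else -1) * direction 1)"
  "chord_linking K p02 p12 = - direction 0 * direction 1 *
     (strand_step 0 2 + strand_step 2 1 - strand_step 0 1 - (if e = 1 then 1 else -1) * direction 2)"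
proof -
  note link = chord_linking_oriented[OF generic]
  have "linking (param 0 0) (param 1 0) (param 0 (e / 2)) (param 2 (e / 2)) =
     strand_step 0 2 + strand_step 1 0 - strand_step 1 2 + (if e = 1 then 1 else -1) * direction 0"
    unfolding linking_def using e by (elim disjE) (simp_all add: steps)
  note X = link[OF crossings(1,2), unfolded this]
  show "chord_linking K p01 p02 = direction 1 * direction 2 *
     (strand_step 0 2 + strand_step 1 0 - strand_step 1 2 + (if e = 1 then 1 else -1) * direction 0)"
    \<comment> \<open>The direction of the shared strand occurs twice in the prefactor and squares
      to 1.\<close>
    unfolding X using direction_cases[of 0] by (elim disjE) simp_all
  have "linking (param 0 0) (param 1 0) (param 1 (- e / 2)) (param 2 (- e / 2)) =
     strand_step 0 2 - strand_step 0 1 - strand_step 1 2 + (if e = 1 then 1 else -1) * direction 1"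
    unfolding linking_def using e by (elim disjE) (simp_all add: steps)
  note X = link[OF crossings(1,3), unfolded this]
  show "chord_linking K p01 p12 = - direction 0 * direction 2 *
     (strand_step 0 2 - strand_step 0 1 - strand_step 1 2 + (if e = 1 then 1 else -1) * direction 1)"
    unfolding X using direction_cases[of 1] by (elim disjE) simp_all
  have "linking (param 0 (e / 2)) (param 2 (e / 2)) (param 1 (- e / 2)) (param 2 (- e / 2)) =
     strand_step 0 2 + strand_step 2 1 - strand_step 0 1 - (if e = 1 then 1 else -1) * direction 2"
    unfolding linking_def using e by (elim disjE) (simp_all add: steps)
  note X = link[OF crossings(2,3), unfolded this]
  show "chord_linking K p02 p12 = - direction 0 * direction 1 *
     (strand_step 0 2 + strand_step 2 1 - strand_step 0 1 - (if e = 1 then 1 else -1) * direction 2)"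
    unfolding X using direction_cases[of 2] by (elim disjE) simp_all
qed

text \<open>The terms depending on \<open>e\<close>, that is, on the order of the crossings on each strand, cancel.\<close>

lemma triangle_sums:
  "(\<Sum>d\<in>inner. chord_linking K p01 d) =
     direction 1 * direction 2 * (strand_step 0 2 + strand_step 1 0 - strand_step 1 2) -
     direction 0 * direction 2 * (strand_step 0 2 - strand_step 0 1 - strand_step 1 2)"
  "(\<Sum>d\<in>inner. chord_linking K p02 d) =
     - direction 1 * direction 2 * (strand_step 0 2 + strand_step 1 0 - strand_step 1 2) -
     direction 0 * direction 1 * (strand_step 0 2 + strand_step 2 1 - strand_step 0 1)"
  "(\<Sum>d\<in>inner. chord_linking K p12 d) =
     direction 0 * direction 2 * (strand_step 0 2 - strand_step 0 1 - strand_step 1 2) +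
     direction 0 * direction 1 * (strand_step 0 2 + strand_step 2 1 - strand_step 0 1)"
proof -
  have anti: "chord_linking K p02 p01 = - chord_linking K p01 p02"
    "chord_linking K p12 p01 = - chord_linking K p01 p12"
    "chord_linking K p12 p02 = - chord_linking K p02 p12"
    unfolding chord_linking_def by (rule linking_antisym)+
  have self: "chord_linking K p p = 0" for p by (simp add: chord_linking_def)
  show "(\<Sum>d\<in>inner. chord_linking K p01 d) =
     direction 1 * direction 2 * (strand_step 0 2 + strand_step 1 0 - strand_step 1 2) -
     direction 0 * direction 2 * (strand_step 0 2 - strand_step 0 1 - strand_step 1 2)"
    unfolding sum_inner self triangle_linking by (simp add: algebra_simps)
  show "(\<Sum>d\<in>inner. chord_linking K p02 d) =
     - direction 1 * direction 2 * (strand_step 0 2 + strand_step 1 0 - strand_step 1 2) -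
     direction 0 * direction 1 * (strand_step 0 2 + strand_step 2 1 - strand_step 0 1)"
    unfolding sum_inner self anti triangle_linking by (simp add: algebra_simps)
  show "(\<Sum>d\<in>inner. chord_linking K p12 d) =
     direction 0 * direction 2 * (strand_step 0 2 - strand_step 0 1 - strand_step 1 2) +
     direction 0 * direction 1 * (strand_step 0 2 + strand_step 2 1 - strand_step 0 1)"
    unfolding sum_inner self anti triangle_linking by (simp add: algebra_simps)
qed

lemma outer_linking:
  assumes "d \<in> outer"
  shows "chord_linking K d p01 = - direction 0 * direction 1 * strand_linking d 0 1"
    "chord_linking K d p02 = - direction 0 * direction 2 * strand_linking d 0 2"
    "chord_linking K d p12 = direction 1 * direction 2 * strand_linking d 1 2"
    "chord_linking K p01 d = direction 0 * direction 1 * strand_linking d 0 1"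
    "chord_linking K p02 d = direction 0 * direction 2 * strand_linking d 0 2"
    "chord_linking K p12 d = - direction 1 * direction 2 * strand_linking d 1 2"
  using chord_linking_outer[OF assms _ _ _ _ crossings(1)] chord_linking_outer[OF assms _ _ _ _ crossings(2)]
    chord_linking_outer[OF assms _ _ _ _ crossings(3)]
    chord_linking_outer'[OF assms _ _ _ _ crossings(1)] chord_linking_outer'[OF assms _ _ _ _ crossings(2)]
    chord_linking_outer'[OF assms _ _ _ _ crossings(3)] e_bounds(4-6)
  by (simp_all add: T_simps(4))

lemma signs:
  "crossing_sign K p01 = - direction 0 * direction 1 * (if h 0 > h 1 then 1 else -1)"
  "crossing_sign K p02 = - direction 0 * direction 2 * (if h 0 > h 2 then 1 else -1)"
  "crossing_sign K p12 = direction 1 * direction 2 * (if h 1 > h 2 then 1 else -1)"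
  using crossing_sign_oriented[OF _ _ _ _ _ crossings(1)] crossing_sign_oriented[OF _ _ _ _ _ crossings(2)]
    crossing_sign_oriented[OF _ _ _ _ _ crossings(3)] e_bounds(4-6)
  by (simp_all add: T_simps(4))

end

text \<open>The crossings correspond by the pair of strands that meet there. None of the sums to
  compare depends on \<open>e\<close>, and both signs use the same heights \<open>h\<close>.\<close>

lemma v_inv_R3:
  assumes K: "singular_knot_diagram K" "singular_knot_diagram K'"
    and move: "picture_move R3_before R3_after K K'"
  shows "v_inv n K = v_inv n K'"
proof -
  obtain c r h where "window_move K K' R3_before R3_after c r h"
    using window_moveI[OF K move] .
  then interpret window_move K K' R3_before R3_after c r h .
  interpret P: R3_diagram K R3_before c r h 1
    by unfold_locales (simp_all add: R3_picture_eq)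
  interpret P': R3_diagram K' R3_after c r h "- 1"
    by unfold_locales (simp_all add: R3_picture_eq)
  have "(\<Sum>d\<in>A.outer. chord_linking K' q d) = (\<Sum>d\<in>A.outer. chord_linking K p d)"
    if "(p, q) \<in> {(P.p01, P'.p01), (P.p02, P'.p02), (P.p12, P'.p12)}" for p q
    using that P.outer_linking(4-6) P'.outer_linking(4-6) unfolding outer_eq
    by (intro sum.cong refl) (auto simp: strand_linking_outside)
  then have index: "chord_index K' (classical_crossings K') P'.p01 = chord_index K (classical_crossings K) P.p01"
    "chord_index K' (classical_crossings K') P'.p02 = chord_index K (classical_crossings K) P.p02"
    "chord_index K' (classical_crossings K') P'.p12 = chord_index K (classical_crossings K) P.p12"
    unfolding A.chord_index_split B.chord_index_split outer_eq P.triangle_sums P'.triangle_sums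
    by simp_all
  show ?thesis
  proof (rule v_inv_window_eqI)
    fix p assume p: "p \<in> A.outer"
    then have p': "p \<in> B.outer" by (simp add: outer_eq)
    show "(\<Sum>d\<in>B.inner. chord_linking K' p d) = (\<Sum>d\<in>A.inner. chord_linking K p d)"
      unfolding P.sum_inner P'.sum_inner P.outer_linking[OF p] P'.outer_linking[OF p']
        strand_linking_outside[OF p] ..
  next
    show "(\<Sum>p\<in>B.inner. contribution n (crossing_sign K' p) (chord_index K' (classical_crossings K') p)) =
      (\<Sum>p\<in>A.inner. contribution n (crossing_sign K p) (chord_index K (classical_crossings K) p))"
      unfolding P.sum_inner P'.sum_inner index P.signs P'.signs ..
  qed
qed

section \<open>Singular diagrams\<close>

lemma v_inv_virtual_move:
  assumes "virtual_move K K'" "n \<ge> 1"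
  shows "v_inv n K = v_inv n K'"
  using assms(1)
proof cases
  case (isotopy H)
  then show ?thesis using v_inv_isotopy virtual_imp_singular by blast
next
  case (reparametrization \<phi>)
  then show ?thesis using v_inv_reparametrization virtual_imp_singular by blast
next
  case R1
  then show ?thesis using v_inv_R1 assms(2) virtual_imp_singular by blast
next
  case R2
  then show ?thesis using v_inv_R2 virtual_imp_singular by blast
next
  case R3
  then show ?thesis using v_inv_R3 virtual_imp_singular by blast
next
  case detour
  then show ?thesis using v_inv_detour virtual_imp_singular by blast
qed

lemma virtual_knot_invariant_v_inv:
  assumes "n \<ge> 1"
  shows "virtual_knot_invariant (v_inv n)"
proof -
  have "v_inv n K = v_inv n K'" if "equivclp virtual_move K K'" for K K'
    using that by (induction rule: equivclp_induct) (use v_inv_virtual_move[OF _ assms] in auto)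
  then show ?thesis by (simp add: virtual_knot_invariant_def virtually_isotopic_def)
qed

section \<open>Resolutions of nodes and the extension to singular diagrams\<close>

definition resolve :: "complex \<Rightarrow> real \<Rightarrow> real \<Rightarrow> vdiagram \<Rightarrow> vdiagram" where
  "resolve p x y K = K\<lparr>over := over K \<union> {u. u - x \<in> \<int>}, under := under K \<union> {u. u - y \<in> \<int>},
     nodes := nodes K - {p}\<rparr>"

lemma resolve_simps [simp]:
  "curve (resolve p x y K) = curve K" "over (resolve p x y K) = over K \<union> {u. u - x \<in> \<int>}"
  "under (resolve p x y K) = under K \<union> {u. u - y \<in> \<int>}" "nodes (resolve p x y K) = nodes K - {p}"
  by (simp_all add: resolve_def)

text \<open>Chords and their linking depend on the immersed curve alone, so a resolution affects a
  chord index only through the set of crossings summed over.\<close>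

lemma same_curve:
  assumes "curve K' = curve K"
  shows "generic_closed_curve K' = generic_closed_curve K" "double_points K' = double_points K"
    "crossing_at K' = crossing_at K" "left_incoming K' = left_incoming K"
    "left_param K' = left_param K" "right_param K' = right_param K"
    "chord_linking K' = chord_linking K" "chord_index K' = chord_index K"
proof -
  show dp: "double_points K' = double_points K" by (simp add: double_points_def assms)
  show "generic_closed_curve K' = generic_closed_curve K"
    by (simp add: generic_closed_curve_def dp assms)
  show ca: "crossing_at K' = crossing_at K"
    by (simp add: fun_eq_iff crossing_at_def assms)
  show "left_incoming K' = left_incoming K" by (simp add: fun_eq_iff left_incoming_eq ca)
  show params: "left_param K' = left_param K" "right_param K' = right_param K"
    by (simp_all add: fun_eq_iff left_param_def right_param_def left_incoming_eq right_incoming_eq ca)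
  show cl: "chord_linking K' = chord_linking K" by (simp add: fun_eq_iff chord_linking_def params)
  show "chord_index K' = chord_index K" by (simp add: fun_eq_iff chord_index_def cl)
qed

lemma singular_resolve:
  assumes K: "singular_knot_diagram K" and p: "p \<in> nodes K"
    and xy: "curve K x = p" "curve K y = p" "x - y \<notin> \<int>"
  shows "singular_knot_diagram (resolve p x y K)"
    and "classical_crossings (resolve p x y K) = insert p (classical_crossings K)"
proof -
  note G = singular_imp_generic[OF K]
  note D = singular_knot_diagramD[OF K]
  have on_p: "curve K u = p" if "u - x \<in> \<int> \<or> u - y \<in> \<int>" for u
    using that curve_Ints[OF G, of u x] curve_Ints[OF G, of u y] xy(1,2) by auto
  have not_p: "curve K u \<noteq> p" if "u \<in> over K \<union> under K" for u
    using that D(6) p crossing_param_iff[OF K, of u] by blast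
  have x0: "x - x \<in> \<int>" by simp
  show cc: "classical_crossings (resolve p x y K) = insert p (classical_crossings K)"
  proof -
    have "curve K ` ({u. u - x \<in> \<int>} \<union> {u. u - y \<in> \<int>}) = {p}"
      using on_p x0 xy(1) by blast
    then show ?thesis by (auto simp: classical_crossings_def)
  qed
  have not_both: "\<not> (u - x \<in> \<int> \<and> u - y \<in> \<int>)" for u
    using Ints_diff[of "u - y" "u - x"] xy(3) by auto
  have shift: "u + 1 - z \<in> \<int> \<longleftrightarrow> u - z \<in> \<int>" for u z :: real
  proof -
    have "u + 1 - z = (u - z) + 1" "u - z = (u + 1 - z) - 1" by simp_all
    then show ?thesis using Ints_add[OF _ Ints_1] Ints_diff[OF _ Ints_1] by metis
  qed
  \<comment> \<open>At \<open>p\<close> the two passages are congruent to \<open>x\<close> and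
    \<open>y\<close> in some order, and neither was a crossing parameter before; away from
    \<open>p\<close> nothing changes.\<close>
  have pair: "u \<in> over K \<or> u - x \<in> \<int> \<longleftrightarrow> v \<in> under K \<or> v - y \<in> \<int>"
    if uv: "curve K u = curve K v" "u - v \<notin> \<int>" for u v
  proof (cases "curve K u = p")
    case True
    then have vp: "curve K v = p" using uv by simp
    have "u - x \<in> \<int> \<or> u - y \<in> \<int>" by (rule double_point_cases[OF G xy True])
    moreover have "v - x \<in> \<int> \<or> v - y \<in> \<int>" by (rule double_point_cases[OF G xy vp])
    moreover have "\<not> (u - x \<in> \<int> \<and> v - x \<in> \<int>)" "\<not> (u - y \<in> \<int> \<and> v - y \<in> \<int>)"
      using Ints_diff[of "u - x" "v - x"] Ints_diff[of "u - y" "v - y"] uv(2) by auto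
    moreover have "u \<notin> over K" "v \<notin> under K" using not_p True vp by blast+
    ultimately show ?thesis by blast
  next
    case False
    then have "\<not> u - x \<in> \<int>" "\<not> v - y \<in> \<int>" using on_p uv(1) by metis+
    then show ?thesis using over_iff_under[OF K uv] by blast
  qed
  show "singular_knot_diagram (resolve p x y K)"
    unfolding singular_knot_diagram_def classical_crossings_def[symmetric] cc
      same_curve(1,2)[OF resolve_simps(1)]
  proof (intro conjI allI impI)
    show "generic_closed_curve K" by (rule G)
    show "u + 1 \<in> over (resolve p x y K) \<longleftrightarrow> u \<in> over (resolve p x y K)"
      "u + 1 \<in> under (resolve p x y K) \<longleftrightarrow> u \<in> under (resolve p x y K)" for u
      using D(1,2) by (simp_all add: shift)
    show "over (resolve p x y K) \<inter> under (resolve p x y K) = {}"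
      using D(3) not_both on_p not_p unfolding resolve_simps by blast
    show "insert p (classical_crossings K) \<subseteq> double_points K"
      using p D(5) classical_crossings_subset[OF K] by blast
    show "u \<in> over (resolve p x y K) \<longleftrightarrow> v \<in> under (resolve p x y K)"
      if "curve (resolve p x y K) u = curve (resolve p x y K) v \<and> u - v \<notin> \<int>" for u v
      using pair[of u v] that by simp
    show "nodes (resolve p x y K) \<subseteq> double_points K" using D(5) by auto
    show "nodes (resolve p x y K) \<inter> insert p (classical_crossings K) = {}" using D(6) by auto
  qed
qed

lemma node_crossing_at:
  assumes "singular_knot_diagram K" "p \<in> nodes K"
  shows "crossing_at K p (left_param K p) (right_param K p)"
  using crossing_at_params[OF singular_imp_generic[OF assms(1)]] singular_knot_diagramD(5)[OF assms(1)]
    assms(2) by blast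

lemma resolve_positive_negative_eq:
  assumes K: "singular_knot_diagram K" and p: "p \<in> nodes K"
  shows "resolve_positive p K = resolve p (left_param K p) (right_param K p) K"
    and "resolve_negative p K = resolve p (right_param K p) (left_param K p) K"
proof -
  note G = singular_imp_generic[OF K]
  note lr = node_crossing_at[OF K p]
  have "left_incoming K p = {u. u - left_param K p \<in> \<int>}" "right_incoming K p = {u. u - right_param K p \<in> \<int>}"
    using mem_left_incoming_iff[OF G lr] mem_right_incoming_iff[OF G lr] by auto
  then show "resolve_positive p K = resolve p (left_param K p) (right_param K p) K"
    "resolve_negative p K = resolve p (right_param K p) (left_param K p) K"
    by (simp_all add: resolve_positive_def resolve_negative_def resolve_def)
qed

lemma crossing_sign_resolve:
  assumes K: "singular_knot_diagram K" and p: "p \<in> nodes K"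
    and xy: "curve K x = p" "curve K y = p" and q: "q \<noteq> p"
  shows "crossing_sign (resolve p x y K) q = crossing_sign K q"
proof -
  have "u \<in> over (resolve p x y K) \<longleftrightarrow> u \<in> over K" if u: "u \<in> left_incoming K q" for u
  proof -
    have "curve K u \<noteq> p" using u q by (simp add: left_incoming_def)
    then have "\<not> u - x \<in> \<int>" using curve_Ints[OF singular_imp_generic[OF K], of u x] xy(1) by auto
    then show ?thesis by simp
  qed
  then have "(\<exists>u\<in>left_incoming K q. u \<in> over (resolve p x y K)) \<longleftrightarrow> (\<exists>u\<in>left_incoming K q. u \<in> over K)"
    by (rule bex_cong[OF refl])
  then show ?thesis
    by (simp only: crossing_sign_def same_curve(4)[OF resolve_simps(1)])
qed

text \<open>The node counts as a crossing in its own index, as it does in either resolution. With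
  chord index \<open>i\<close> the bracket is \<open>(1 + (- 1) ^ n) * (i / 2) ^ n\<close>, so it
  vanishes for odd \<open>n\<close>.\<close>

definition node_jump :: "nat \<Rightarrow> vdiagram \<Rightarrow> complex \<Rightarrow> real" where
  "node_jump n K p = 1 / fact n *
     (contribution n 1 (chord_index K (insert p (classical_crossings K)) p) -
      contribution n (- 1) (chord_index K (insert p (classical_crossings K)) p))"

text \<open>Both resolutions have the same crossings and the same chord indices, and the signs away
  from \<open>p\<close> agree. Only the term of \<open>p\<close> itself survives in the
  difference.\<close>

lemma v_inv_node_jump:
  assumes K: "singular_knot_diagram K" and p: "p \<in> nodes K"
  shows "v_inv n (resolve_positive p K) - v_inv n (resolve_negative p K) = node_jump n K p"
proof -
  note G = singular_imp_generic[OF K]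
  let ?l = "left_param K p" and ?r = "right_param K p"
  let ?C = "insert p (classical_crossings K)"
  note lr = node_crossing_at[OF K p]
  have lp: "curve K ?l = p" and rp: "curve K ?r = p" using lr by (auto simp: crossing_at_def)
  have pC: "p \<notin> classical_crossings K" using singular_knot_diagramD(6)[OF K] p by blast
  have fin: "finite (classical_crossings K)" by (rule finite_classical_crossings[OF K])
  have v: "v_inv n (resolve p x y K) = 1 / fact n *
      (contribution n s (chord_index K ?C p) +
       (\<Sum>q\<in>classical_crossings K. contribution n (crossing_sign K q) (chord_index K ?C q)))"
    if xy: "curve K x = p" "curve K y = p" "x - y \<notin> \<int>"
      and s: "crossing_sign (resolve p x y K) p = s" for x y s
  proof -
    note R = singular_resolve[OF K p xy]
    have "(\<Sum>q\<in>classical_crossings K. contribution n (crossing_sign (resolve p x y K) q) (chord_index K ?C q))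
      = (\<Sum>q\<in>classical_crossings K. contribution n (crossing_sign K q) (chord_index K ?C q))"
    proof (rule sum.cong[OF refl])
      fix q assume "q \<in> classical_crossings K"
      then have "q \<noteq> p" using pC by blast
      from crossing_sign_resolve[OF K p xy(1,2) this]
      show "contribution n (crossing_sign (resolve p x y K) q) (chord_index K ?C q) =
          contribution n (crossing_sign K q) (chord_index K ?C q)"
        by simp
    qed
    then show ?thesis
      unfolding v_inv_eq[OF R(1)] R(2) same_curve(8)[OF resolve_simps(1)]
      by (simp add: sum.insert[OF fin pC] s)
  qed
  have nI: "?l - ?r \<notin> \<int>" by (rule crossing_at_not_Ints[OF G lr])
  then have nI': "?r - ?l \<notin> \<int>" using Ints_diff_commute by blast
  have "?l \<notin> over K" using pC lp crossing_param_iff[OF K, of ?l] by auto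
  then have "crossing_sign (resolve p ?l ?r K) p = 1" "crossing_sign (resolve p ?r ?l K) p = - 1"
    using crossing_sign_eq[OF singular_resolve(1)[OF K p lp rp nI], of p ?l ?r]
      crossing_sign_eq[OF singular_resolve(1)[OF K p rp lp nI'], of p ?l ?r] lr nI
    by (simp_all add: same_curve(3)[OF resolve_simps(1)])
  from v[OF lp rp nI this(1)] v[OF rp lp nI' this(2)]
  show ?thesis
    unfolding resolve_positive_negative_eq[OF K p] node_jump_def
    by (simp add: algebra_simps)
qed

text \<open>A resolved node joins the classical crossings whatever its sign, and
  \<open>node_jump\<close> reads nothing else from it.\<close>

lemma node_jump_resolve:
  "node_jump n (resolve_positive p K) q = node_jump n (resolve_negative p K) q"
proof -
  have "over K \<union> left_incoming K p \<union> (under K \<union> right_incoming K p) =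
      over K \<union> right_incoming K p \<union> (under K \<union> left_incoming K p)" by blast
  then have "classical_crossings (resolve_positive p K) = classical_crossings (resolve_negative p K)"
    by (simp add: classical_crossings_def resolve_positive_def resolve_negative_def)
  moreover have "chord_index (resolve_positive p K) = chord_index (resolve_negative p K)"
    by (rule same_curve(8)) (simp add: resolve_positive_def resolve_negative_def)
  ultimately show ?thesis by (simp add: node_jump_def)
qed

definition v_inv_extension :: "nat \<Rightarrow> vdiagram \<Rightarrow> real" where
  "v_inv_extension n K =
     (if card (nodes K) = 0 then v_inv n K
      else if card (nodes K) = 1 then \<Sum>p\<in>nodes K. node_jump n K p
      else 0)"

lemma vassiliev_extension_v_inv: "vassiliev_extension (v_inv n) (v_inv_extension n)"
  unfolding vassiliev_extension_def
proof (intro conjI allI impI ballI)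
  fix K assume "virtual_knot_diagram K"
  then show "v_inv_extension n K = v_inv n K"
    by (simp add: virtual_knot_diagram_def v_inv_extension_def)
next
  fix K p assume K: "singular_knot_diagram K" and p: "p \<in> nodes K"
  let ?f = "v_inv_extension n" and ?P = "resolve_positive p K" and ?N = "resolve_negative p K"
  have nodes: "nodes ?P = nodes K - {p}" "nodes ?N = nodes K - {p}"
    by (simp_all add: resolve_positive_def resolve_negative_def)
  \<comment> \<open>Without finiteness \<open>card\<close> would be 0 and the case distinction in
    \<open>v_inv_extension\<close> would not count nodes.\<close>
  have fin: "finite (nodes K)"
    using singular_knot_diagramD(5)[OF K] generic_closed_curveD(3)[OF singular_imp_generic[OF K]]
    by (rule finite_subset)
  then have card: "card (nodes K) = Suc (card (nodes K - {p}))"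
    using p by (metis card.remove)
  show "?f K = ?f ?P - ?f ?N"
  proof (cases "card (nodes K) = 1")
    case True
    then have "nodes K = {p}" using p by (auto simp: card_1_singleton_iff)
    then show ?thesis
      using v_inv_node_jump[OF K p, of n] by (simp add: v_inv_extension_def nodes)
  next
    \<comment> \<open>There are at least two nodes. With exactly two, the resolutions have one node
      left, with equal jumps; with more, both values are already 0.\<close>
    case False
    then show ?thesis
      using card by (simp add: v_inv_extension_def nodes node_jump_resolve)
  qed
qed

theorem mainTheorem2:
  fixes n :: nat
  assumes "n \<ge> 1"
  shows "vassiliev_invariant_of_order (nat \<lceil>real n / 2\<rceil>) (v_inv n)"
proof -
  have "v_inv_extension n K = 0" if "card (nodes K) > nat \<lceil>real n / 2\<rceil>" for K
  proof -
    \<comment> \<open>Hence more nodes than the bound means at least two, where the extension is 0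
      by definition.\<close>
    have "nat \<lceil>real n / 2\<rceil> \<ge> 1" using assms by (simp add: le_nat_iff le_ceiling_iff)
    then have "card (nodes K) > 1" using that by linarith
    then show ?thesis by (simp add: v_inv_extension_def)
  qed
  then show ?thesis
    unfolding vassiliev_invariant_of_order_def
    using virtual_knot_invariant_v_inv[OF assms] vassiliev_extension_v_inv by blast
qed

end
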